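(* Let $\Sigma$ be a fixed $d\times d$ positive definite matrix, and let $A_i = \Sigma^{1/2} G_i^{\rm c}$ $(i=1,2,\dots)$, where the $G_i^{\rm c}$ are independent $d\times d$ complex Gaussian matrices whose entries are independent standard complex normals. Let $y_1,\dots,y_d$ denote the eigenvalues of $\Sigma^{-1}$, let $P_N = A_N A_{N-1}\cdots A_1$, and let $L(q)=\lim_{N\to\infty}\frac1N\log\big\langle \|P_N\|^q\big\rangle$ be the generalized maximum Lyapunov exponent. Then $$L(q) = \log\bigg(\Gamma(1+q/2)\,\frac{1}{\prod_{1\le j<l\le d}(y_l-y_j)}\,\det M\bigg),$$ where $M$ is the $d\times d$ matrix with first row $M_{1j} = y_j^{-q/2}$ and remaining rows $M_{ij} = y_j^{i-1}$ $(i=2,\dots,d)$, $j=1,\dots,d$. If some of the $y_j$ coincide, the right-hand side is understood as its limiting value from distinct $y_1,\dots,y_d>0$.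
   Context: A standard complex normal is a complex random variable with density $\pi^{-1}e^{-|z|^2}$ on $\mathbb{C}$ (so $\langle |z|^2\rangle = 1$). $\langle\cdot\rangle$ denotes expectation. $\Sigma^{1/2}$ is the positive definite square root. $\Gamma$ is the gamma function. The matrix norm is $\|P\| = \sup_{\vec x:\,|\vec x|=1}|P\vec x|$, with $|\cdot|$ the Euclidean norm on $\mathbb{C}^d$.
   Formalization: The formula for L(q) is proved for real q > -2; the statement gives no range for q, but at q = -2 the factor Γ(1+q/2) has a pole, and below it the formula fails (e.g. d = 1, q = -3, infinite moments; or d = 2, Σ = I, -4 < q < -2). *)

theory Defs
  imports "HOL-Probability.Probability"
begin

text \<open>
  The dimension \<open>d\<close> is \<open>CARD('d)\<close> for a finite linearly ordered index type \<open>'d\<close>; the order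
  gives meaning to products over \<open>j < l\<close> and to row numbers.
\<close>

definition conj_transpose :: "complex^'n^'m \<Rightarrow> complex^'m^'n" where
  "conj_transpose A = (\<chi> i j. cnj (A $ j $ i))"

definition pos_def :: "complex^'d^'d \<Rightarrow> bool" where
  "pos_def A \<longleftrightarrow> conj_transpose A = A \<and>
     (\<forall>x. x \<noteq> 0 \<longrightarrow> 0 < Re (\<Sum>i\<in>UNIV. \<Sum>j\<in>UNIV. cnj (x $ i) * A $ i $ j * x $ j))"

definition pos_def_sqrt :: "complex^'d^'d \<Rightarrow> complex^'d^'d" where
  "pos_def_sqrt A = (THE R. pos_def R \<and> R ** R = A)"

definition mat_norm :: "complex^'d^'d \<Rightarrow> real" where
  "mat_norm P = (SUP x\<in>{x. norm x = 1}. norm (P *v x))"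

text \<open>\<open>y\<close> lists the eigenvalues of \<open>A\<close> with algebraic multiplicity.\<close>

definition eigenvalues_of :: "complex^'d^'d \<Rightarrow> real^'d \<Rightarrow> bool" where
  "eigenvalues_of A y \<longleftrightarrow>
     (\<forall>x. det (mat x - A) = (\<Prod>j\<in>UNIV. (x - complex_of_real (y $ j))))"

definition std_complex_normal :: "'w measure \<Rightarrow> ('w \<Rightarrow> complex) \<Rightarrow> bool" where
  "std_complex_normal M Z \<longleftrightarrow>
     distributed M lborel Z (\<lambda>z. ennreal (exp (- (cmod z)\<^sup>2) / pi))"

definition indep_complex_gaussian_matrices ::
  "'w measure \<Rightarrow> (nat \<Rightarrow> 'w \<Rightarrow> complex^'d^'d) \<Rightarrow> bool" where
  "indep_complex_gaussian_matrices M G \<longleftrightarrow>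
     (\<forall>i\<ge>1. \<forall>j k. std_complex_normal M (\<lambda>\<omega>. G i \<omega> $ j $ k)) \<and>
     prob_space.indep_vars M (\<lambda>_. borel) (\<lambda>(i, j, k) \<omega>. G i \<omega> $ j $ k)
       ({1..} \<times> UNIV \<times> UNIV)"

primrec matrix_product :: "(nat \<Rightarrow> complex^'d^'d) \<Rightarrow> nat \<Rightarrow> complex^'d^'d" where
  "matrix_product A 0 = mat 1"
| "matrix_product A (Suc N) = A (Suc N) ** matrix_product A N"

text \<open>
  The integrability conjunct says that the moments are finite; without it the Bochner
  integral could be the default value \<open>0\<close>.
\<close>

definition has_gen_lyapunov_exponent ::
  "'w measure \<Rightarrow> (nat \<Rightarrow> 'w \<Rightarrow> complex^'d^'d) \<Rightarrow> real \<Rightarrow> real \<Rightarrow> bool" where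
  "has_gen_lyapunov_exponent M A q L \<longleftrightarrow>
     (\<forall>N. integrable M (\<lambda>\<omega>. mat_norm (matrix_product (\<lambda>i. A i \<omega>) N) powr q)) \<and>
     (\<lambda>N. 1 / real N *
        ln (\<integral>\<omega>. mat_norm (matrix_product (\<lambda>i. A i \<omega>) N) powr q \<partial>M)) \<longlonglongrightarrow> L"

text \<open>The position of an index, counted from \<open>1\<close>.\<close>

definition position :: "'d::{finite,linorder} \<Rightarrow> nat" where
  "position i = card {k. k \<le> i}"

definition lyapunov_matrix :: "real \<Rightarrow> real^'d::{finite,linorder} \<Rightarrow> real^'d::{finite,linorder}^'d::{finite,linorder}" where
  "lyapunov_matrix q y =
     (\<chi> i j. if position i = 1 then (y $ j) powr (- q / 2) else (y $ j) ^ (position i - 1))"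

definition lyapunov_formula :: "real \<Rightarrow> real^'d::{finite,linorder} \<Rightarrow> real" where
  "lyapunov_formula q y =
     ln (Gamma (1 + q / 2) * (1 / (\<Prod>(j, l)\<in>{(j, l). j < l}. (y $ l - y $ j)))
         * det (lyapunov_matrix q y))"

definition distinct_positive :: "(real^'d) set" where
  "distinct_positive = {y. (\<forall>j. 0 < y $ j) \<and> inj (\<lambda>j. y $ j)}"

end

theory Submission imports Defs begin

text \<open>
  A complex Gaussian matrix \<open>H\<close> has a law that is invariant under \<open>H \<mapsto> U ** H ** V\<close> for unitary
  \<open>U\<close> and \<open>V\<close>. Hence the vector \<open>pos_def_sqrt S ** H *v v\<close> depends on \<open>v\<close>, in law, only through
  the factor \<open>norm v\<close>, and a diagonalisation of \<open>S\<close> shows that the square of its norm is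
  \<open>(norm v)\<^sup>2\<close> times \<open>X = (\<Sum>j. (cmod (H $ j $ a))\<^sup>2 / y $ j)\<close> for any fixed column \<open>a\<close>
  (\<open>norm_moment\<close>). Conditioning on the first \<open>N\<close> factors, the expectation of
  \<open>norm (P\<^sub>N *v v) powr q\<close> is exactly \<open>m ^ N * norm v powr q\<close>, where \<open>m\<close> is the expectation of
  \<open>X powr (q / 2)\<close> (\<open>norm_product_moment\<close>).

  The matrix norm differs from the norm of a single image vector by no more than a constant factor
  in the mean (\<open>mat_norm_moment_upper\<close>, \<open>mat_norm_moment_lower\<close>), so the exponent is \<open>ln m\<close>. For
  \<open>q \<ge> 0\<close> the comparison with the columns of \<open>P\<^sub>N\<close> is deterministic. For \<open>q < 0\<close> the lower bound
  needs another idea, because a single vector may be shrunk much more than the norm indicates: one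
  averages over a Gaussian vector \<open>x\<close>. An entry of \<open>P *v x\<close> is a complex normal scaled
  by the length of a row of \<open>P\<close>, and its modulus has a finite \<open>q\<close>-th moment precisely if \<open>q > -2\<close>.

  The summands of \<open>X\<close> are independent exponential variables with rates \<open>y $ j\<close>. For distinct rates
  their sum has a density that is a linear combination of the exponential densities, whose
  coefficients are the values at \<open>0\<close> of the Lagrange basis polynomials for the nodes \<open>y $ j\<close>
  (\<open>hypoexponential_distributed\<close>). Thus \<open>m\<close> is the gamma factor times the value at \<open>0\<close> of the polynomial that
  interpolates \<open>x powr (- q / 2)\<close> at these nodes. The quotient of determinants in the formula is the
  same number: replacing the first row of the matrix by the interpolating polynomial and
  subtracting multiples of the other rows leaves only the constant coefficient of this polynomial,
  times the Vandermonde determinant (\<open>det_lyapunov_matrix\<close>).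

  For coinciding eigenvalues it remains to see that \<open>m\<close> depends continuously on \<open>y\<close>. This follows
  from monotonicity and homogeneity of \<open>X\<close>, which make \<open>ln m\<close> Lipschitz in the logarithms of the
  \<open>y $ j\<close> (\<open>column_moment_compare\<close>).
\<close>

section \<open>Hermitian and unitary matrices\<close>

text \<open>
  A maximiser of the quadratic form \<open>x \<bullet> f x\<close> on the unit sphere of \<open>W\<close> is an eigenvector. Working
  inside an invariant subspace is what makes the construction of an eigenbasis by induction
  possible.
\<close>
lemma self_adjoint_eigenvector:
  fixes f :: "'a::euclidean_space \<Rightarrow> 'a"
  assumes lin: "linear f" and sa: "\<And>x y. f x \<bullet> y = x \<bullet> f y"
    and W: "subspace W" "f ` W \<subseteq> W" "w0 \<in> W" "w0 \<noteq> 0"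
  obtains v l where "v \<in> W" "norm v = 1" "f v = l *\<^sub>R v"
proof -
  let ?S = "W \<inter> sphere 0 1"
  have "(1 / norm w0) *\<^sub>R w0 \<in> ?S"
    using W by (auto simp: subspace_scale)
  then have ne: "?S \<noteq> {}" by blast
  have comp: "compact ?S"
    using W(1) by (intro closed_Int_compact closed_subspace) auto
  have "continuous_on ?S (\<lambda>x. x \<bullet> f x)"
    by (intro continuous_intros linear_continuous_on linear_conv_bounded_linear[THEN iffD1] lin)
  from continuous_attains_sup[OF comp ne this]
  obtain v where v: "v \<in> W" "norm v = 1" and max: "\<And>w. w \<in> ?S \<Longrightarrow> w \<bullet> f w \<le> v \<bullet> f v"
    by auto
  define l where "l = v \<bullet> f v"
  define b where "b = l *\<^sub>R v - f v"
  have nn: "w \<bullet> f w \<le> l * (w \<bullet> w)" if "w \<in> W" for w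
  proof (cases "w = 0")
    case True then show ?thesis by simp
  next
    case False
    let ?u = "(1 / norm w) *\<^sub>R w"
    have "?u \<in> ?S" using that False W(1) by (auto simp: subspace_scale)
    then have "?u \<bullet> f ?u \<le> l" using max l_def by blast
    moreover have "?u \<bullet> f ?u = (w \<bullet> f w) / (norm w)\<^sup>2"
      by (simp only: linear_scale[OF lin] inner_scaleR_left inner_scaleR_right) (simp add: power2_eq_square)
    ultimately have "(w \<bullet> f w) / (norm w)\<^sup>2 \<le> l" by simp
    then show ?thesis using False
      by (simp add: pos_divide_le_eq power2_norm_eq_inner)
  qed
  have bW: "b \<in> W" using W v by (auto simp: b_def subspace_scale subspace_diff)
  have "0 \<le> 2 * t * (b \<bullet> b) + t\<^sup>2 * (l * (b \<bullet> b) - b \<bullet> f b)" for t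
  proof -
    have "v + t *\<^sub>R b \<in> W" using bW v W(1) by (auto simp: subspace_add subspace_scale)
    from nn[OF this] have "0 \<le> l * ((v + t *\<^sub>R b) \<bullet> (v + t *\<^sub>R b)) - (v + t *\<^sub>R b) \<bullet> f (v + t *\<^sub>R b)"
      by simp
    also have "\<dots> = l * (v \<bullet> v) - v \<bullet> f v + 2 * t * (l * (v \<bullet> b) - f v \<bullet> b)
        + t\<^sup>2 * (l * (b \<bullet> b) - b \<bullet> f b)"
      using lin sa[of v b] by (simp add: linear_add linear_scale inner_add_left inner_add_right
          inner_commute algebra_simps power2_eq_square)
    also have "l * (v \<bullet> b) - f v \<bullet> b = b \<bullet> b"
      by (simp add: b_def inner_diff_left inner_diff_right algebra_simps)
    also have "l * (v \<bullet> v) - v \<bullet> f v = 0"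
      using v by (simp add: l_def dot_square_norm)
    finally show ?thesis by simp
  qed
  note quad = this
  \<comment> \<open>Moving from \<open>v\<close> a little against \<open>b\<close> would make the nonnegative form negative.\<close>
  have "b \<bullet> b \<le> 0"
  proof (rule ccontr)
    assume "\<not> b \<bullet> b \<le> 0"
    then have bp: "b \<bullet> b > 0" by (rule not_le_imp_less)
    define c where "c = \<bar>l * (b \<bullet> b) - b \<bullet> f b\<bar> + 1"
    have c: "c > 0" "l * (b \<bullet> b) - b \<bullet> f b \<le> c" by (auto simp: c_def)
    let ?t = "- (b \<bullet> b) / c"
    have "0 \<le> 2 * ?t * (b \<bullet> b) + ?t\<^sup>2 * (l * (b \<bullet> b) - b \<bullet> f b)" by (rule quad)
    also have "\<dots> \<le> 2 * ?t * (b \<bullet> b) + ?t\<^sup>2 * c"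
      using c by (intro add_left_mono mult_left_mono) auto
    also have "\<dots> = - ((b \<bullet> b)\<^sup>2 / c)"
      using c by (simp add: field_simps power2_eq_square)
    also have "\<dots> < 0" using bp c by simp
    finally show False by simp
  qed
  then have "b = 0" using inner_gt_zero_iff[of b] by (metis not_le)
  then have "f v = l *\<^sub>R v" by (simp add: b_def)
  with v that show ?thesis by blast
qed

definition cinner :: "complex^'n \<Rightarrow> complex^'n \<Rightarrow> complex" where
  "cinner x y = (\<Sum>i\<in>UNIV. cnj (x $ i) * y $ i)"

definition unitary_matrix :: "complex^'n^'n \<Rightarrow> bool" where
  "unitary_matrix U \<longleftrightarrow> conj_transpose U ** U = mat 1"

definition diag_matrix :: "real^'n \<Rightarrow> complex^'n^'n" where
  "diag_matrix l = (\<chi> i j. if i = j then complex_of_real (l $ i) else 0)"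

lemma inner_eq_Re_cinner: "x \<bullet> y = Re (cinner x y)"
  by (simp add: cinner_def inner_vec_def inner_complex_def)

lemma cinner_matrix_vector: "cinner (A *v x) y = cinner x (conj_transpose A *v y)"
proof -
  have "cinner (A *v x) y = (\<Sum>i\<in>UNIV. \<Sum>j\<in>UNIV. cnj (A $ i $ j) * cnj (x $ j) * y $ i)"
    by (simp add: cinner_def matrix_vector_mult_def sum_distrib_right)
  also have "\<dots> = (\<Sum>j\<in>UNIV. \<Sum>i\<in>UNIV. cnj (A $ i $ j) * cnj (x $ j) * y $ i)"
    by (rule sum.swap)
  also have "\<dots> = cinner x (conj_transpose A *v y)"
    by (simp add: cinner_def matrix_vector_mult_def conj_transpose_def sum_distrib_left algebra_simps)
  finally show ?thesis .
qed

lemma cinner_self: "cinner x x = complex_of_real ((norm x)\<^sup>2)"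
proof -
  have "cinner x x = (\<Sum>i\<in>UNIV. complex_of_real ((cmod (x $ i))\<^sup>2))"
    unfolding cinner_def by (intro sum.cong refl) (simp add: complex_norm_square mult.commute flip: of_real_power)
  also have "\<dots> = complex_of_real ((norm x)\<^sup>2)"
    by (simp add: norm_vec_def L2_set_def sum_nonneg)
  finally show ?thesis .
qed

lemma cinner_commute: "cinner y x = cnj (cinner x y)"
  by (simp add: cinner_def mult.commute)

lemma cinner_scaleR_right: "cinner x (c *\<^sub>R y) = of_real c * cinner x y"
  by (simp add: cinner_def sum_distrib_left scaleR_conv_of_real[where 'a=complex] algebra_simps)

lemma cinner_scaleR_left: "cinner (c *\<^sub>R y) x = of_real c * cinner y x"
  by (simp add: cinner_def sum_distrib_left scaleR_conv_of_real[where 'a=complex] algebra_simps)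

lemma cinner_add_right: "cinner x (y + z) = cinner x y + cinner x z"
  by (simp add: cinner_def algebra_simps sum.distrib)

lemma conj_transpose_conj_transpose [simp]: "conj_transpose (conj_transpose A) = A"
  by (simp add: conj_transpose_def vec_eq_iff)

lemma conj_transpose_mult: "conj_transpose (A ** B) = conj_transpose B ** conj_transpose A"
  by (simp add: conj_transpose_def vec_eq_iff matrix_matrix_mult_def mult.commute)

lemma norm_axis_one: "norm (axis j 1 :: complex^'d) = 1"
  using cinner_self[of "axis j 1 :: complex^'d"]
  by (simp add: cinner_def axis_def mult_delta_right if_distrib[of cnj] mult_delta_left power2_eq_1_iff
      flip: of_real_power) (metis norm_ge_zero not_one_le_zero neg_0_le_iff_le)

lemma unitary_columns:
  "unitary_matrix (\<chi> i j. e j $ i) \<longleftrightarrow> (\<forall>i j. cinner (e i) (e j) = (if i = j then 1 else 0))"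
  by (simp add: unitary_matrix_def conj_transpose_def matrix_matrix_mult_def vec_eq_iff mat_def
      cinner_def)

lemma unitary_norm:
  assumes "unitary_matrix U" shows "norm (U *v x) = norm x"
proof -
  have "cinner (U *v x) (U *v x) = cinner x x"
    using assms by (simp add: cinner_matrix_vector matrix_vector_mul_assoc unitary_matrix_def)
  then have "(norm (U *v x))\<^sup>2 = (norm x)\<^sup>2"
    unfolding cinner_self by (metis of_real_eq_iff)
  then show ?thesis by simp
qed

lemma unitary_conj_transpose:
  assumes "unitary_matrix U"
  shows "unitary_matrix (conj_transpose U)" "U ** conj_transpose U = mat 1"
  using assms matrix_left_right_inverse[of "conj_transpose U" U]
  by (simp_all add: unitary_matrix_def)

definition orthonormal_eigenvectors ::
  "complex^'d^'d \<Rightarrow> 'd set \<Rightarrow> ('d \<Rightarrow> complex^'d) \<Rightarrow> ('d \<Rightarrow> real) \<Rightarrow> bool" where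
  "orthonormal_eigenvectors A I e l \<longleftrightarrow>
     (\<forall>i\<in>I. \<forall>j\<in>I. cinner (e i) (e j) = (if i = j then 1 else 0)) \<and>
     (\<forall>i\<in>I. A *v e i = l i *\<^sub>R e i)"

text \<open>
  The vectors \<open>e i\<close> with \<open>i \<in> I\<close>, padded with zero rows, form a square matrix with a zero row, which
  therefore has a kernel.
\<close>
lemma orthogonal_vector_exists:
  fixes e :: "'d::finite \<Rightarrow> complex^'d"
  assumes "k \<notin> I"
  obtains w where "w \<noteq> 0" "\<And>i. i \<in> I \<Longrightarrow> cinner (e i) w = 0"
proof -
  let ?B = "(\<chi> i j. if i \<in> I then cnj (e i $ j) else 0) :: complex^'d^'d"
  have "row k ?B = 0" using assms by (simp add: row_def vec_eq_iff)
  then have "det ?B = 0" by (rule det_zero_row)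
  then have "\<not> invertible ?B" by (simp add: invertible_det_nz)
  then obtain w where w: "?B *v w = 0" "w \<noteq> 0"
    by (auto simp: invertible_left_inverse matrix_left_invertible_ker)
  have "cinner (e i) w = 0" if "i \<in> I" for i
    using w(1) that by (auto simp: vec_eq_iff matrix_vector_mult_def cinner_def dest: spec[of _ i])
  with w that show ?thesis by blast
qed

text \<open>
  Starting from an arbitrary orthonormal family serves two purposes: the empty family
  gives the spectral theorem, and a single unit vector, with \<open>A = 0\<close>, gives a unitary matrix with
  a prescribed column.
\<close>
lemma extend_orthonormal_eigenvectors:
  fixes A :: "complex^'d^'d"
  assumes A: "conj_transpose A = A" and I: "orthonormal_eigenvectors A I e l"
  shows "\<exists>e' l'. orthonormal_eigenvectors A UNIV e' l' \<and> (\<forall>i\<in>I. e' i = e i)"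
proof -
  have "\<exists>e' l'. orthonormal_eigenvectors A (I \<union> J) e' l' \<and> (\<forall>i\<in>I. e' i = e i)"
    if "finite J" "J \<inter> I = {}" for J
    using that
  proof (induction J)
    case empty then show ?case using I by auto
  next
    case (insert k J)
    then obtain e' l' where e': "orthonormal_eigenvectors A (I \<union> J) e' l'" "\<forall>i\<in>I. e' i = e i"
      by auto
    have k: "k \<notin> I \<union> J" using insert by auto
    define W where "W = {w. \<forall>i\<in>I\<union>J. cinner (e' i) w = 0}"
    have inv: "(*v) A ` W \<subseteq> W"
    proof (clarsimp simp: W_def)
      fix w i assume w: "\<forall>i\<in>I\<union>J. cinner (e' i) w = 0" and i: "i \<in> I \<or> i \<in> J"
      have "cinner (e' i) (A *v w) = cinner (A *v e' i) w"
        by (simp add: cinner_matrix_vector A)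
      also have "\<dots> = cinner (l' i *\<^sub>R e' i) w"
        using e'(1) i by (auto simp: orthonormal_eigenvectors_def)
      also have "\<dots> = 0"
        using w i by (auto simp: cinner_scaleR_left)
      finally show "cinner (e' i) (A *v w) = 0" .
    qed
    have sub: "subspace W"
      by (auto simp: subspace_def W_def cinner_add_right cinner_scaleR_right) (simp_all add: cinner_def)
    obtain w0 where w0: "w0 \<noteq> 0" "\<And>i. i \<in> I \<union> J \<Longrightarrow> cinner (e' i) w0 = 0"
      using orthogonal_vector_exists[OF k] by metis
    have "w0 \<in> W" unfolding W_def using w0(2) by blast
    moreover note w0(1)
    moreover have "linear ((*v) A)" by (rule linearI) (simp_all add: vec_eq_iff
       matrix_vector_mult_def scaleR_sum_right distrib_left sum.distrib)
    note sa = self_adjoint_eigenvector[OF this _ sub inv]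
    moreover have "(A *v x) \<bullet> y = x \<bullet> (A *v y)" for x y
      by (simp add: inner_eq_Re_cinner cinner_matrix_vector A)
    ultimately obtain v c where v: "v \<in> W" "norm v = 1" "A *v v = c *\<^sub>R v"
      using sa[of w0] by blast
    have vv: "cinner v v = 1" using v by (simp add: cinner_self)
    have v0: "cinner (e' i) v = 0" "cinner v (e' i) = 0" if "i \<in> I \<union> J" for i
      using v(1) that cinner_commute[of v "e' i"] by (auto simp: W_def)
    have "orthonormal_eigenvectors A (I \<union> insert k J) (e'(k := v)) (l'(k := c))"
      using e'(1) v(3) vv v0 k unfolding orthonormal_eigenvectors_def by auto
    moreover have "\<forall>i\<in>I. (e'(k := v)) i = e i" using e'(2) k by auto
    ultimately show ?case by blast
  qed
  from this[of "- I"] show ?thesis by auto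
qed

lemma unitary_with_column:
  fixes x :: "complex^'d"
  assumes "norm x = 1"
  obtains V where "unitary_matrix V" "V *v axis a 1 = x"
proof -
  have "orthonormal_eigenvectors (mat 0) {a} (\<lambda>_. x) (\<lambda>_. 0)"
    using assms by (auto simp: orthonormal_eigenvectors_def cinner_self vec_eq_iff matrix_vector_mult_def mat_def)
  moreover have "conj_transpose (mat 0) = (mat 0 :: complex^'d^'d)"
    by (simp add: conj_transpose_def mat_def vec_eq_iff)
  ultimately obtain e l where e: "orthonormal_eigenvectors (mat 0) UNIV e l" "e a = x"
    using extend_orthonormal_eigenvectors by (metis singletonI)
  let ?V = "\<chi> i j. e j $ i"
  have "unitary_matrix ?V" using e by (simp add: unitary_columns orthonormal_eigenvectors_def)
  moreover have "?V *v axis a 1 = x"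
    using e(2) by (simp add: matrix_vector_mult_def axis_def vec_eq_iff if_distrib cong: if_cong)
  ultimately show ?thesis using that by blast
qed

lemma spectral_theorem:
  fixes A :: "complex^'d^'d"
  assumes "conj_transpose A = A"
  obtains U l where "unitary_matrix U" "A = U ** diag_matrix l ** conj_transpose U"
proof -
  have "orthonormal_eigenvectors A {} (\<lambda>_. 0) (\<lambda>_. 0)" by (simp add: orthonormal_eigenvectors_def)
  then obtain e l where e: "orthonormal_eigenvectors A UNIV e l"
    using extend_orthonormal_eigenvectors[OF assms] by blast
  let ?U = "\<chi> i j. e j $ i"
  let ?l = "\<chi> i. l i"
  have U: "unitary_matrix ?U" using e by (simp add: unitary_columns orthonormal_eigenvectors_def)
  have "A ** ?U = ?U ** diag_matrix ?l"
  proof -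
    have "(A ** ?U) $ i $ j = (?U ** diag_matrix ?l) $ i $ j" for i j
    proof -
      have "(A ** ?U) $ i $ j = (A *v e j) $ i"
        by (simp add: matrix_matrix_mult_def matrix_vector_mult_def)
      also have "\<dots> = of_real (l j) * e j $ i"
        using e by (simp add: orthonormal_eigenvectors_def scaleR_conv_of_real[where 'a=complex])
      also have "\<dots> = (?U ** diag_matrix ?l) $ i $ j"
        by (simp add: matrix_matrix_mult_def diag_matrix_def if_distrib mult.commute cong: if_cong)
      finally show ?thesis .
    qed
    then show ?thesis by (simp add: vec_eq_iff)
  qed
  then have "A ** (?U ** conj_transpose ?U) = ?U ** diag_matrix ?l ** conj_transpose ?U"
    by (simp add: matrix_mul_assoc)
  then have "A = ?U ** diag_matrix ?l ** conj_transpose ?U"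
    using unitary_conj_transpose(2)[OF U] by simp
  with U that show ?thesis by blast
qed


lemma diag_matrix_mult_vector: "(diag_matrix l *v x) $ j = complex_of_real (l $ j) * x $ j"
  by (simp add: diag_matrix_def matrix_vector_mult_def mult_delta_left mult_delta_right)

lemma diag_matrix_mult: "diag_matrix k ** diag_matrix l = diag_matrix (\<chi> j. k $ j * l $ j)"
  by (simp add: diag_matrix_def matrix_matrix_mult_def vec_eq_iff mult_delta_left mult_delta_right)

lemma conj_transpose_diag_matrix: "conj_transpose (diag_matrix l) = diag_matrix l"
  by (simp add: diag_matrix_def conj_transpose_def vec_eq_iff)

lemma pos_def_iff_inner:
  "pos_def A \<longleftrightarrow> conj_transpose A = A \<and> (\<forall>x. x \<noteq> 0 \<longrightarrow> 0 < x \<bullet> (A *v x))"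
proof -
  have "(\<Sum>i\<in>UNIV. \<Sum>j\<in>UNIV. cnj (x $ i) * A $ i $ j * x $ j) = cinner x (A *v x)" for x
    by (simp add: cinner_def matrix_vector_mult_def sum_distrib_left mult.assoc)
  then show ?thesis by (simp add: pos_def_def inner_eq_Re_cinner)
qed

abbreviation unitary_diag :: "complex^'d^'d \<Rightarrow> real^'d \<Rightarrow> complex^'d^'d" where
  "unitary_diag U l \<equiv> U ** diag_matrix l ** conj_transpose U"

lemma inner_unitary_diag:
  "x \<bullet> (unitary_diag U l *v x) = (\<Sum>j\<in>UNIV. l $ j * (cmod ((conj_transpose U *v x) $ j))\<^sup>2)"
proof -
  let ?z = "conj_transpose U *v x"
  have "cinner x (unitary_diag U l *v x) = cinner ?z (diag_matrix l *v ?z)"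
    by (simp add: cinner_matrix_vector flip: matrix_vector_mul_assoc)
  also have "\<dots> = (\<Sum>j\<in>UNIV. complex_of_real (l $ j * (cmod (?z $ j))\<^sup>2))"
    unfolding cinner_def diag_matrix_mult_vector
    by (intro sum.cong refl) (simp add: complex_norm_square mult_ac del: of_real_power)
  finally show ?thesis by (simp add: inner_eq_Re_cinner del: of_real_mult)
qed

lemma pos_def_unitary_diag:
  assumes U: "unitary_matrix U"
  shows "pos_def (unitary_diag U l) \<longleftrightarrow> (\<forall>j. 0 < l $ j)"
proof -
  have herm: "conj_transpose (unitary_diag U l) = unitary_diag U l"
    by (simp add: conj_transpose_mult conj_transpose_diag_matrix matrix_mul_assoc)
  show ?thesis
  proof
    assume pd: "pos_def (unitary_diag U l)"
    show "\<forall>j. 0 < l $ j"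
    proof
      fix j
      let ?x = "U *v axis j 1"
      have z: "conj_transpose U *v ?x = axis j 1"
        using U by (simp add: matrix_vector_mul_assoc unitary_matrix_def)
      have "norm ?x = 1" using unitary_norm[OF U, of "axis j 1"] by (simp add: norm_axis_one)
      then have "?x \<noteq> 0" by (metis norm_zero zero_neq_one)
      then have "0 < ?x \<bullet> (unitary_diag U l *v ?x)"
        using pd unfolding pos_def_iff_inner by blast
      also have "\<dots> = l $ j"
        unfolding inner_unitary_diag z
        by (simp add: axis_def if_distrib[of cmod] if_distrib[of "\<lambda>x. x\<^sup>2"] mult_delta_right cong: if_cong)
      finally show "0 < l $ j" .
    qed
  next
    assume l: "\<forall>j. 0 < l $ j"
    have "0 < x \<bullet> (unitary_diag U l *v x)" if "x \<noteq> 0" for x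
    proof -
      let ?z = "conj_transpose U *v x"
      have "norm ?z = norm x" by (rule unitary_norm[OF unitary_conj_transpose(1)[OF U]])
      then have "?z \<noteq> 0" using that by force
      then obtain k where "?z $ k \<noteq> 0" by (auto simp: vec_eq_iff)
      moreover have "0 \<le> l $ i" for i using l less_imp_le by blast
      ultimately show ?thesis unfolding inner_unitary_diag
        using l by (intro sum_pos2[where i = k]) auto
    qed
    then show "pos_def (unitary_diag U l)" using herm by (auto simp: pos_def_iff_inner)
  qed
qed

lemma unitary_diag_mult:
  assumes "unitary_matrix U"
  shows "unitary_diag U k ** unitary_diag U l = unitary_diag U (\<chi> j. k $ j * l $ j)"
proof -
  have "unitary_diag U k ** unitary_diag U l
      = U ** diag_matrix k ** (conj_transpose U ** U) ** diag_matrix l ** conj_transpose U"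
    by (simp add: matrix_mul_assoc)
  also have "\<dots> = U ** (diag_matrix k ** diag_matrix l) ** conj_transpose U"
    using assms by (simp add: unitary_matrix_def matrix_mul_assoc)
  finally show ?thesis by (simp add: diag_matrix_mult)
qed

lemma matrix_diff_vector: "(A - B) *v (x :: complex^'d) = A *v x - B *v x"
  by (simp add: matrix_vector_mult_def vec_eq_iff left_diff_distrib sum_subtractf)

text \<open>
  Uniqueness: if \<open>R\<close> is a positive definite root and \<open>u\<close> an eigenvector for \<open>s\<^sup>2\<close> with \<open>s > 0\<close>, then
  \<open>v = R *v u - s u\<close> satisfies \<open>R *v v = - s v\<close>, so that \<open>v = 0\<close> by positivity of \<open>R\<close>. Hence \<open>R\<close>
  acts on the eigenbasis in the only possible way.
\<close>
lemma pos_def_sqrt_unitary_diag: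
  assumes U: "unitary_matrix U" and l: "\<And>j. 0 < l $ j"
  shows "pos_def_sqrt (unitary_diag U l) = unitary_diag U (\<chi> j. sqrt (l $ j))"
  unfolding pos_def_sqrt_def
proof (rule the_equality)
  let ?T = "unitary_diag U (\<chi> j. sqrt (l $ j))"
  have "(\<chi> j. sqrt (l $ j) * sqrt (l $ j)) = l" using l by (simp add: vec_eq_iff less_imp_le)
  then show "pos_def ?T \<and> ?T ** ?T = unitary_diag U l"
    using l by (simp add: pos_def_unitary_diag[OF U] unitary_diag_mult[OF U])
  fix R assume R: "pos_def R \<and> R ** R = unitary_diag U l"
  have "R *v column j U = of_real (sqrt (l $ j)) *s column j U" for j
  proof -
    let ?s = "complex_of_real (sqrt (l $ j))"
    let ?u = "column j U"
    have uU: "?u = U *v axis j 1" by (simp add: column_def axis_def matrix_vector_mult_def vec_eq_iff mult_delta_right)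
    have "conj_transpose U *v ?u = axis j 1"
      using U by (simp add: uU matrix_vector_mul_assoc unitary_matrix_def)
    then have "(R ** R) *v ?u = U *v (diag_matrix l *v axis j 1)"
      using R by (simp flip: matrix_vector_mul_assoc)
    also have "diag_matrix l *v axis j 1 = of_real (l $ j) *s axis j 1"
      by (simp add: vec_eq_iff diag_matrix_mult_vector axis_def)
    also have "U *v \<dots> = of_real (l $ j) *s ?u"
      by (simp add: uU matrix_vector_mult_scaleR vector_scalar_commute)
    finally have RR: "R *v (R *v ?u) = (?s * ?s) *s ?u"
      using l[of j] by (simp add: matrix_vector_mul_assoc less_imp_le flip: of_real_mult)
    define v where "v = R *v ?u - ?s *s ?u"
    have "R *v v = - sqrt (l $ j) *\<^sub>R v"
      by (simp add: v_def matrix_vector_mult_diff_distrib RR vector_scalar_commute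
          vec_eq_iff scaleR_conv_of_real[where 'a=complex] algebra_simps)
    then have "v \<bullet> (R *v v) \<le> 0"
      using l[of j] by (simp add: mult_nonneg_nonneg less_imp_le)
    then have "v = 0" using R unfolding pos_def_iff_inner by (meson not_le)
    then show ?thesis by (simp add: v_def)
  qed
  then have "R ** U = U ** diag_matrix (\<chi> j. sqrt (l $ j))"
    by (simp add: vec_eq_iff matrix_matrix_mult_def diag_matrix_def matrix_vector_mult_def column_def
        mult_delta_left mult_delta_right mult.commute)
  then have "R ** (U ** conj_transpose U) = ?T" by (simp add: matrix_mul_assoc)
  then show "R = ?T" by (simp add: unitary_conj_transpose(2)[OF U])
qed

lemma norm_pos_def_sqrt_mult:
  assumes U: "unitary_matrix U" and l: "\<And>j. 0 < l $ j"
  shows "(norm (pos_def_sqrt (unitary_diag U l) *v x))\<^sup>2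
    = (\<Sum>j\<in>UNIV. l $ j * (cmod ((conj_transpose U *v x) $ j))\<^sup>2)"
proof -
  let ?T = "unitary_diag U (\<chi> j. sqrt (l $ j))"
  have herm: "conj_transpose ?T = ?T"
    by (simp add: conj_transpose_mult conj_transpose_diag_matrix matrix_mul_assoc)
  have l': "(\<chi> j. sqrt (l $ j) * sqrt (l $ j)) = l" using l by (simp add: vec_eq_iff less_imp_le)
  have "(norm (?T *v x))\<^sup>2 = x \<bullet> (?T *v (?T *v x))"
    using herm by (simp add: power2_norm_eq_inner inner_eq_Re_cinner cinner_matrix_vector)
  also have "?T *v (?T *v x) = unitary_diag U l *v x"
    by (simp only: matrix_vector_mul_assoc unitary_diag_mult[OF U]) (simp only: vec_lambda_beta l')
  finally show ?thesis
    by (simp add: pos_def_sqrt_unitary_diag[OF U l] inner_unitary_diag)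
qed

lemma matrix_inv_eqI:
  fixes A :: "'a::field^'n^'n"
  assumes "A ** B = mat 1" shows "matrix_inv A = B"
proof -
  have "B ** A = mat 1" using assms matrix_left_right_inverse by blast
  then have "invertible A" using assms invertible_def by blast
  then have "A ** matrix_inv A = mat 1" unfolding invertible_def matrix_inv_def
    by (rule someI_ex[THEN conjunct1])
  then have "B ** (A ** matrix_inv A) = B" by simp
  then show ?thesis by (simp add: matrix_mul_assoc \<open>B ** A = mat 1\<close>)
qed

lemma eigenvalues_of_unitary_diag:
  assumes U: "unitary_matrix U"
  shows "eigenvalues_of (unitary_diag U l) l"
  unfolding eigenvalues_of_def
proof
  fix x :: complex
  let ?D = "mat x - diag_matrix l"
  have "U ** ?D ** conj_transpose U = U ** mat x ** conj_transpose U - unitary_diag U l"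
    by (simp add: vec_eq_iff matrix_matrix_mult_def left_diff_distrib right_diff_distrib sum_subtractf)
  also have "U ** mat x = mat x ** U"
    by (simp add: vec_eq_iff matrix_matrix_mult_def mat_def mult_delta_left mult_delta_right mult.commute)
  also have "mat x ** U ** conj_transpose U = mat x ** (U ** conj_transpose U)"
    by (simp add: matrix_mul_assoc)
  finally have "mat x - unitary_diag U l = U ** ?D ** conj_transpose U"
    by (simp add: unitary_conj_transpose(2)[OF U])
  then have "det (mat x - unitary_diag U l) = det ?D * det (U ** conj_transpose U)"
    by (simp add: det_mul)
  also have "\<dots> = det ?D" by (simp add: unitary_conj_transpose(2)[OF U])
  also have "\<dots> = (\<Prod>j\<in>UNIV. ?D $ j $ j)"
    by (rule det_diagonal) (simp add: mat_def diag_matrix_def)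
  also have "\<dots> = (\<Prod>j\<in>UNIV. x - complex_of_real (l $ j))"
    by (simp add: mat_def diag_matrix_def)
  finally show "det (mat x - unitary_diag U l) = (\<Prod>j\<in>UNIV. x - complex_of_real (l $ j))" .
qed

text \<open>Two lists of the roots of one polynomial agree up to order, by unique factorisation.\<close>
lemma eigenvalues_of_unique:
  fixes y l :: "real^'d"
  assumes "eigenvalues_of A y" "eigenvalues_of A l"
  obtains p where "p permutes (UNIV :: 'd set)" "\<And>j. y $ j = l $ p j"
proof -
  define P where "P z = (\<Prod>j\<in>UNIV. [:- complex_of_real (z $ j), 1:])" for z :: "real^'d"
  have roots: "proots (P z) = image_mset (\<lambda>j. complex_of_real (z $ j)) (mset_set UNIV)" for z
    by (simp add: P_def proots_prod sum_unfold_sum_mset)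
  have "poly (P y) = poly (P l)"
    using assms by (auto simp: eigenvalues_of_def P_def poly_prod)
  then have "P y = P l" by (simp add: poly_eq_poly_eq_iff)
  then have "image_mset (\<lambda>j. complex_of_real (y $ j)) (mset_set UNIV)
      = image_mset (\<lambda>j. complex_of_real (l $ j)) (mset_set UNIV)"
    by (simp flip: roots)
  from image_mset_eq_implies_permutes[OF _ this] that show ?thesis by auto
qed

text \<open>
  The columns of the diagonalising matrix are permuted so that they follow the given enumeration
  \<open>y\<close> of the eigenvalues.
\<close>
lemma pos_def_eigenbasis:
  fixes S :: "complex^'d^'d"
  assumes S: "pos_def S" and y: "eigenvalues_of (matrix_inv S) y"
  obtains U where "unitary_matrix U" "S = unitary_diag U (\<chi> j. 1 / y $ j)" "\<And>j. 0 < y $ j"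
proof -
  obtain U l where U: "unitary_matrix U" and Sl: "S = unitary_diag U l"
    using S spectral_theorem unfolding pos_def_def by metis
  have l: "0 < l $ j" for j using S pos_def_unitary_diag[OF U] Sl by auto
  let ?k = "\<chi> j. 1 / l $ j"
  have one: "diag_matrix (\<chi> j. l $ j * ?k $ j) = mat 1"
    using l by (auto simp: diag_matrix_def mat_def vec_eq_iff order_less_imp_not_eq2)
  have "S ** unitary_diag U ?k = mat 1"
    unfolding Sl unitary_diag_mult[OF U] one using unitary_conj_transpose(2)[OF U] by simp
  then have "matrix_inv S = unitary_diag U ?k" by (rule matrix_inv_eqI)
  then have "eigenvalues_of (matrix_inv S) ?k" using eigenvalues_of_unitary_diag[OF U] by simp
  then obtain p where p: "p permutes UNIV" "\<And>j. y $ j = 1 / l $ p j"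
    using eigenvalues_of_unique[OF y] by (metis (no_types, lifting) vec_lambda_beta)
  have ly: "1 / y $ j = l $ p j" for j using p(2) by simp
  let ?U = "\<chi> i j. U $ i $ p j"
  have "\<forall>i j. cinner (column i U) (column j U) = (if i = j then 1 else 0)"
    using U unitary_columns[of "\<lambda>j. column j U"] by (simp add: column_def)
  then have "\<forall>i j. cinner (column (p i) U) (column (p j) U) = (if i = j then 1 else 0)"
    using permutes_inj[OF p(1)] by (auto dest: injD)
  then have "unitary_matrix ?U"
    using unitary_columns[of "\<lambda>j. column (p j) U"] by (simp add: column_def)
  moreover have "S = unitary_diag ?U (\<chi> j. 1 / y $ j)"
  proof -
    have ud: "unitary_diag V z $ i $ k = (\<Sum>j\<in>UNIV. V $ i $ j * of_real (z $ j) * cnj (V $ k $ j))"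
      for V :: "complex^'d^'d" and z i k
      by (simp add: matrix_matrix_mult_def diag_matrix_def conj_transpose_def mult_delta_left mult_delta_right
         )
    have "unitary_diag ?U (\<chi> j. 1 / y $ j) $ i $ k = S $ i $ k" for i k
      unfolding Sl ud vec_lambda_beta ly
      using sum.permute[OF p(1), of "\<lambda>j. U $ i $ j * of_real (l $ j) * cnj (U $ k $ j)"]
      by (simp add: o_def)
    then show ?thesis by (simp add: vec_eq_iff)
  qed
  moreover have "0 < y $ j" for j using p(2) l by simp
  ultimately show ?thesis using that by blast
qed


section \<open>Lagrange interpolation and the determinant formula\<close>

text \<open>The value at \<open>0\<close> of the Lagrange basis polynomial of the node \<open>y j\<close>.\<close>
definition lagrange_weight :: "'a set \<Rightarrow> ('a \<Rightarrow> real) \<Rightarrow> 'a \<Rightarrow> real" where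
  "lagrange_weight I y j = (\<Prod>l\<in>I - {j}. y l / (y l - y j))"

lemma interpolation_at_zero:
  fixes y f :: "'a \<Rightarrow> real"
  assumes I: "finite I" "I \<noteq> {}" "inj_on y I"
  obtains p where "degree p < card I" "\<And>j. j \<in> I \<Longrightarrow> poly p (y j) = f j"
    "poly p 0 = (\<Sum>j\<in>I. f j * lagrange_weight I y j)"
proof -
  define L where "L j = (\<Prod>l\<in>I - {j}. smult (1 / (y j - y l)) [:- y l, 1:])" for j
  define p where "p = (\<Sum>j\<in>I. smult (f j) (L j))"
  have pL: "poly (L j) x = (\<Prod>l\<in>I - {j}. (x - y l) / (y j - y l))" for j x
    by (simp add: L_def poly_prod diff_divide_distrib)
  have "degree (L j) \<le> card I - 1" if "j \<in> I" for j
  proof -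
    have "degree (L j) \<le> (\<Sum>l\<in>I - {j}. degree (smult (1 / (y j - y l)) [:- y l, 1:]))"
      unfolding L_def by (rule degree_prod_sum_le[unfolded o_def]) (use I in auto)
    also have "\<dots> \<le> (\<Sum>l\<in>I - {j}. 1)" by (intro sum_mono) auto
    also have "\<dots> = card I - 1" using that I by simp
    finally show ?thesis .
  qed
  then have "degree p \<le> card I - 1"
    unfolding p_def by (intro degree_sum_le I) (auto intro: order_trans[OF degree_smult_le])
  moreover have "card I > 0" using I by (simp add: card_gt_0_iff)
  ultimately have "degree p < card I" by linarith
  moreover have "poly p (y j) = f j" if j: "j \<in> I" for j
  proof -
    have "poly (L i) (y j) = (if i = j then 1 else 0)" if i: "i \<in> I" for i
    proof (cases "i = j")
      case True
      have "(y j - y l) / (y j - y l) = 1" if "l \<in> I - {j}" for l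
        using that I(3) j by (auto dest: inj_onD)
      then show ?thesis using True by (simp add: pL)
    next
      case False
      then have "\<exists>l\<in>I - {i}. (y j - y l) / (y i - y l) = 0" using j by (auto intro!: bexI[of _ j])
      then show ?thesis using False I(1) by (auto simp: pL intro!: prod_zero)
    qed
    then have "poly p (y j) = (\<Sum>i\<in>I. f i * (if i = j then 1 else 0))"
      by (simp add: p_def poly_sum)
    then show ?thesis using I(1) j by (simp add: mult_delta_right)
  qed
  moreover have "(0 - y l) / (y j - y l) = y l / (y l - y j)" for j l
    by (metis diff_0 minus_diff_eq minus_divide_divide)
  then have "poly p 0 = (\<Sum>j\<in>I. f j * lagrange_weight I y j)"
    by (simp add: p_def poly_sum pL lagrange_weight_def)
  ultimately show ?thesis using that by blast
qed

lemma lagrange_at_zero: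
  fixes y :: "'a \<Rightarrow> real"
  assumes I: "finite I" "inj_on y I" and p: "degree p < card I"
  shows "(\<Sum>j\<in>I. poly p (y j) * lagrange_weight I y j) = poly p 0"
proof -
  have "I \<noteq> {}" using p by auto
  then obtain r where r: "degree r < card I" "\<And>j. j \<in> I \<Longrightarrow> poly r (y j) = poly p (y j)"
    "poly r 0 = (\<Sum>j\<in>I. poly p (y j) * lagrange_weight I y j)"
    using interpolation_at_zero[OF I(1) _ I(2), of "\<lambda>j. poly p (y j)"] by blast
  have "r = p"
    by (rule poly_eqI_degree[where A = "y ` I"]) (use r p I(2) in \<open>auto simp: card_image\<close>)
  with r(3) show ?thesis by simp
qed

text \<open>
  The index type is only linearly ordered, so sums over rows are translated to sums over
  natural numbers by means of \<open>position\<close>.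
\<close>
lemma position_less_iff: "position i < position j \<longleftrightarrow> i < (j :: 'd::{finite,linorder})"
proof -
  have "position i < position j" if "i < j" for i j :: 'd
    unfolding position_def using that by (intro psubset_card_mono) (auto simp: psubset_eq set_eq_iff intro!: exI[of _ j])
  then show ?thesis by (metis less_asym linorder_neqE order_less_irrefl)
qed

lemma position_pos: "0 < position (i :: 'd::{finite,linorder})"
  by (auto simp: position_def card_gt_0_iff)

lemma position_eq_iff: "position i = position j \<longleftrightarrow> i = (j :: 'd::{finite,linorder})"
  by (metis less_irrefl linorder_neqE position_less_iff)

lemma bij_betw_position:
  "bij_betw (\<lambda>i :: 'd::{finite,linorder}. position i - 1) UNIV {..<CARD('d)}"
proof -
  have inj: "inj (\<lambda>i :: 'd. position i - 1)"
  proof (rule injI)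
    fix i j :: 'd assume "position i - 1 = position j - 1"
    then have "position i = position j" using position_pos[of i] position_pos[of j] by linarith
    then show "i = j" by (simp add: position_eq_iff)
  qed
  have "position i \<le> CARD('d)" for i :: 'd unfolding position_def by (intro card_mono) auto
  then have sub: "range (\<lambda>i :: 'd. position i - 1) \<subseteq> {..<CARD('d)}"
    using position_pos by (auto simp: Suc_le_eq intro!: less_le_trans[OF diff_less])
  have "range (\<lambda>i :: 'd. position i - 1) = {..<CARD('d)}"
    by (rule card_subset_eq[OF _ sub]) (simp_all add: card_image[OF inj] del: One_nat_def)
  with inj show ?thesis by (simp add: bij_betw_def)
qed

lemma sum_coeff_position:
  fixes p :: "real poly"
  assumes "degree p < CARD('d::{finite,linorder})"
  shows "(\<Sum>k\<in>(UNIV :: 'd set). coeff p (position k - 1) * x ^ (position k - 1)) = poly p x"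
proof -
  have "(\<Sum>k\<in>(UNIV :: 'd set). coeff p (position k - 1) * x ^ (position k - 1))
      = (\<Sum>n<CARD('d). coeff p n * x ^ n)"
    by (rule sum.reindex_bij_betw[OF bij_betw_position])
  also have "\<dots> = (\<Sum>n\<le>degree p. coeff p n * x ^ n)"
    using assms by (intro sum.mono_neutral_right) (auto simp: coeff_eq_0)
  finally show ?thesis by (simp add: poly_altdef)
qed

text \<open>
  A permutation \<open>p\<close> with \<open>i \<le> p i\<close> for all \<open>i\<close> is the identity, because the positions of all indices have
  the same sum before and after permuting.
\<close>
lemma det_upper_triangular:
  fixes A :: "real^'d::{finite,linorder}^'d::{finite,linorder}"
  assumes "\<And>i j. j < i \<Longrightarrow> A $ i $ j = 0"
  shows "det A = (\<Prod>i\<in>UNIV. A $ i $ i)"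
proof -
  have zero: "(\<Prod>i\<in>UNIV. A $ i $ p i) = 0" if p: "p permutes UNIV" "p \<noteq> id" for p
  proof (rule ccontr)
    assume nz: "(\<Prod>i\<in>UNIV. A $ i $ p i) \<noteq> 0"
    have "\<not> p i < i" for i using nz assms by auto
    then have le: "position i \<le> position (p i)" for i
      using position_less_iff not_less by blast
    have "(\<Sum>i\<in>UNIV. position (p i)) = (\<Sum>i\<in>(UNIV :: 'd set). position i)"
      using sum.permute[OF p(1), of position] unfolding o_def by (rule sym)
    then have "position i = position (p i)" for i
      using sum_mono_inv[of position UNIV "\<lambda>i. position (p i)" i] le by simp
    then show False using p(2) by (auto simp: position_eq_iff fun_eq_iff)
  qed
  have "det A = (\<Sum>p\<in>{id}. of_int (sign p) * (\<Prod>i\<in>UNIV. A $ i $ p i))"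
    unfolding det_def
    by (rule sum.mono_neutral_right) (auto simp: permutes_id zero intro!: zero finite_permutations)
  then show ?thesis by simp
qed

text \<open>
  Unitriangular row operations turn the monomials into the Newton polynomials
  \<open>\<Prod>m<i. (x - y m)\<close>, whose values at the nodes form a triangular matrix.
\<close>
lemma det_vandermonde:
  fixes y :: "real^'d::{finite,linorder}"
  shows "det (\<chi> i j. (y $ j) ^ (position i - 1) :: real^'d::{finite,linorder}^'d::{finite,linorder})
    = (\<Prod>(j, l)\<in>{(j, l). j < l}. y $ l - y $ j)"
proof -
  let ?V = "\<chi> i j. (y $ j) ^ (position i - 1) :: real^'d::{finite,linorder}^'d::{finite,linorder}"
  define p where "p i = (\<Prod>m\<in>{m. m < i}. [:- y $ m, 1:])" for i
  let ?N = "\<chi> i k. coeff (p i) (position k - 1) :: real^'d::{finite,linorder}^'d::{finite,linorder}"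
  have deg: "degree (p i) = position i - 1" for i
  proof -
    have "{k. k \<le> i} = insert i {m. m < i}" by auto
    then have "position i = Suc (card {m. m < i})" by (simp add: position_def)
    moreover have "degree (p i) = (\<Sum>m\<in>{m. m < i}. degree [:- y $ m, 1:])"
      unfolding p_def by (rule degree_prod_eq_sum_degree) auto
    ultimately show ?thesis by simp
  qed
  have monic: "coeff (p i) (position i - 1) = 1" for i
    unfolding deg[symmetric] by (simp add: p_def lead_coeff_prod)
  have "degree (p i) < CARD('d)" for i
    using bij_betw_position[where 'd='d] unfolding deg bij_betw_def by blast
  then have NV: "?N ** ?V = (\<chi> i j. poly (p i) (y $ j))"
    by (simp add: matrix_matrix_mult_def sum_coeff_position del: One_nat_def)
  have "det (transpose ?N) = 1"
  proof (subst det_upper_triangular)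
    fix i j :: 'd assume "j < i"
    then have "degree (p j) < position i - 1"
      using position_less_iff[of j i] position_pos[of j] by (simp add: deg)
    then show "transpose ?N $ i $ j = 0" by (simp add: transpose_def coeff_eq_0)
  qed (simp add: transpose_def monic del: One_nat_def)
  then have "det ?V = det (?N ** ?V)" by (simp add: det_mul det_transpose)
  also have "\<dots> = (\<Prod>i\<in>UNIV. (?N ** ?V) $ i $ i)"
    unfolding NV by (rule det_upper_triangular) (auto simp: p_def poly_prod intro!: prod_zero)
  also have "\<dots> = (\<Prod>l\<in>UNIV. \<Prod>j\<in>{j. j < l}. y $ l - y $ j)"
    unfolding NV by (simp add: p_def poly_prod)
  also have "\<dots> = (\<Prod>(l, j)\<in>(SIGMA l:UNIV. {j. j < l}). y $ l - y $ j)"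
    by (rule prod.Sigma) auto
  also have "\<dots> = (\<Prod>(j, l)\<in>{(j, l). j < l}. y $ l - y $ j)"
    by (rule prod.reindex_bij_witness[of _ "\<lambda>(j, l). (l, j)" "\<lambda>(l, j). (j, l)"]) auto
  finally show ?thesis .
qed

text \<open>
  Let \<open>p\<close> interpolate \<open>x powr (- q / 2)\<close> at the nodes. The matrix is the Vandermonde matrix multiplied
  from the left by the identity matrix whose first row is replaced by the coefficients of \<open>p\<close>;
  that factor is triangular with determinant \<open>poly p 0\<close>.
\<close>
lemma det_lyapunov_matrix:
  fixes y :: "real^'d::{finite,linorder}"
  assumes inj: "inj (\<lambda>j. y $ j)"
  shows "det (lyapunov_matrix q y) = (\<Prod>(j, l)\<in>{(j, l). j < l}. y $ l - y $ j)
    * (\<Sum>j\<in>UNIV. (y $ j) powr (- q / 2) * lagrange_weight UNIV (($) y) j)"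
proof -
  let ?V = "\<chi> i j. (y $ j) ^ (position i - 1) :: real^'d::{finite,linorder}^'d::{finite,linorder}"
  obtain p where p: "degree p < CARD('d)" "\<And>j. poly p (y $ j) = (y $ j) powr (- q / 2)"
    "poly p 0 = (\<Sum>j\<in>UNIV. (y $ j) powr (- q / 2) * lagrange_weight UNIV (($) y) j)"
    using interpolation_at_zero[of "UNIV :: 'd set" "($) y" "\<lambda>j. (y $ j) powr (- q / 2)"] inj by auto
  let ?K = "\<chi> i k. if position i = 1 then coeff p (position k - 1) else if i = k then 1 else 0 :: real^'d::{finite,linorder}^'d::{finite,linorder}"
  have "lyapunov_matrix q y = ?K ** ?V"
  proof -
    have "lyapunov_matrix q y $ i $ j = (?K ** ?V) $ i $ j" for i j
      using p(1,2) by (simp add: lyapunov_matrix_def matrix_matrix_mult_def sum_coeff_position mult_delta_left del: One_nat_def)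
    then show ?thesis by (simp add: vec_eq_iff)
  qed
  then have "det (lyapunov_matrix q y) = det ?K * det ?V" by (simp add: det_mul)
  also have "det ?K = (\<Prod>i\<in>UNIV. ?K $ i $ i)"
  proof (rule det_upper_triangular)
    fix i j :: 'd assume "j < i"
    then show "?K $ i $ j = 0" using position_less_iff[of j i] position_pos[of j] by auto
  qed
  also have "\<dots> = poly p 0"
  proof -
    have "0 \<in> (\<lambda>i :: 'd. position i - 1) ` UNIV"
      using bij_betw_position[where 'd='d] by (auto simp: bij_betw_def)
    then obtain a :: 'd where "position a - 1 = 0" by auto
    then have a: "position a = 1" using position_pos[of a] by simp
    have "?K $ i $ i = (if i = a then poly p 0 else 1)" for i
      using a position_eq_iff[of i a] by (auto simp: poly_0_coeff_0)
    then show ?thesis by simp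
  qed
  finally show ?thesis by (simp only: det_vandermonde p(3) mult.commute)
qed

lemma lyapunov_formula_eq:
  fixes y :: "real^'d::{finite,linorder}"
  assumes inj: "inj (\<lambda>j. y $ j)"
  shows "lyapunov_formula q y =
    ln (Gamma (1 + q / 2) * (\<Sum>j\<in>UNIV. (y $ j) powr (- q / 2) * lagrange_weight UNIV (($) y) j))"
proof -
  let ?V = "\<Prod>(j, l)\<in>{(j, l). j < l}. y $ l - y $ j"
  have nz: "?V \<noteq> 0" using inj by (subst prod_zero_iff) (auto dest: injD)
  have cancel: "v \<noteq> 0 \<Longrightarrow> a * (1 / v) * (v * b) = a * b" for a b v :: real by simp
  show ?thesis by (simp only: lyapunov_formula_def det_lyapunov_matrix[OF inj] cancel[OF nz])
qed


section \<open>The Gaussian measure on complex matrices\<close>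
lemma nn_integral_lborel_shift:
  fixes c :: "'a::euclidean_space"
  assumes [measurable]: "g \<in> borel_measurable borel"
  shows "(\<integral>\<^sup>+x. g (c + x) \<partial>lborel) = (\<integral>\<^sup>+x. g x \<partial>lborel)"
proof -
  have "(\<integral>\<^sup>+x. g x \<partial>lborel) = (\<integral>\<^sup>+x. g x \<partial>distr lborel borel ((+) c))"
    by (simp add: lborel_distr_plus)
  also have "\<dots> = (\<integral>\<^sup>+x. g (c + x) \<partial>lborel)" by (rule nn_integral_distr) auto
  finally show ?thesis ..
qed

lemma nn_integral_lborel_reflect:
  fixes c :: "'a::euclidean_space"
  assumes [measurable]: "g \<in> borel_measurable borel"
  shows "(\<integral>\<^sup>+x. g (c - x) \<partial>lborel) = (\<integral>\<^sup>+x. g x \<partial>lborel)"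
proof -
  have "(\<integral>\<^sup>+x. g x \<partial>lborel) = (\<integral>\<^sup>+x. g x \<partial>distr lborel borel (\<lambda>x. c + (-1) *\<^sub>R x))"
    by (subst lborel_affine[of "-1" c]) (simp_all add: density_1)
  also have "\<dots> = (\<integral>\<^sup>+x. g (c - x) \<partial>lborel)" by (subst nn_integral_distr) auto
  finally show ?thesis ..
qed

text \<open>
  This is uniqueness of Haar measure in a special case. Translation invariance, Fubini's theorem
  and the linearity of \<open>f\<close> give \<open>\<lambda>(f\<^sup>-\<^sup>1 A) \<lambda>(B) = \<lambda>(A) \<lambda>(f\<^sup>-\<^sup>1 B)\<close> for all Borel sets; for \<open>B\<close> take the
  unit ball, which is its own preimage.
\<close>
lemma lborel_orthogonal_transformation:
  fixes f :: "'a::euclidean_space \<Rightarrow> 'a"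
  assumes f: "orthogonal_transformation f"
  shows "distr lborel borel f = lborel"
proof (rule measure_eqI)
  have lin: "linear f" and nf: "\<And>x. norm (f x) = norm x"
    using f by (auto simp: orthogonal_transformation)
  have [measurable]: "f \<in> borel_measurable borel"
    using lin by (intro borel_measurable_continuous_onI linear_continuous_on)
      (simp add: linear_conv_bounded_linear)
  have cross: "emeasure lborel (f -` A) * emeasure lborel B = emeasure lborel A * emeasure lborel (f -` B)"
    if [measurable]: "A \<in> sets borel" "B \<in> sets borel" for A B
  proof -
    have vim: "f -` C \<in> sets borel" if "C \<in> sets borel" for C
      using measurable_sets[of f borel borel C] that by simp
    have "emeasure lborel (f -` A) * emeasure lborel B
        = (\<integral>\<^sup>+x. indicator A (f x) \<partial>lborel) * (\<integral>\<^sup>+y. indicator B y \<partial>lborel)"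
      using vim[OF that(1)] by (simp add: indicator_vimage[symmetric] o_def flip: nn_integral_indicator)
    also have "\<dots> = (\<integral>\<^sup>+x. indicator A (f x) * (\<integral>\<^sup>+y. indicator B y \<partial>lborel) \<partial>lborel)"
      by (rule nn_integral_multc[symmetric]) simp
    also have "\<dots> = (\<integral>\<^sup>+x. \<integral>\<^sup>+y. indicator A (f x) * indicator B (f x + y) \<partial>lborel \<partial>lborel)"
      by (subst nn_integral_cmult) (simp_all add: nn_integral_lborel_shift[of "indicator B"])
    also have "\<dots> = (\<integral>\<^sup>+y. \<integral>\<^sup>+x. indicator A (f x) * indicator B (f x + y) \<partial>lborel \<partial>lborel)"
      by (rule lborel_pair.Fubini'[symmetric]) measurable
    also have "\<dots> = (\<integral>\<^sup>+y. \<integral>\<^sup>+x. indicator A (f x - y) * indicator B (f x) \<partial>lborel \<partial>lborel)"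
    proof (rule nn_integral_cong)
      fix y
      obtain z where z: "f z = y" using orthogonal_transformation_surj[OF f] by (metis surjD)
      have "(\<integral>\<^sup>+x. indicator A (f x) * indicator B (f x + y) \<partial>lborel)
          = (\<integral>\<^sup>+x. indicator A (f (- z + x)) * indicator B (f (- z + x) + y) \<partial>lborel)"
        by (rule nn_integral_lborel_shift[symmetric, of "\<lambda>x. indicator A (f x) * indicator B (f x + y)"]) measurable
      then show "(\<integral>\<^sup>+x. indicator A (f x) * indicator B (f x + y) \<partial>lborel)
          = (\<integral>\<^sup>+x. indicator A (f x - y) * indicator B (f x) \<partial>lborel)"
        using lin by (simp add: linear_diff linear_add linear_neg z algebra_simps)
    qed
    also have "\<dots> = (\<integral>\<^sup>+x. \<integral>\<^sup>+y. indicator A (f x - y) * indicator B (f x) \<partial>lborel \<partial>lborel)"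
      by (rule lborel_pair.Fubini'[symmetric]) measurable
    also have "\<dots> = (\<integral>\<^sup>+x. emeasure lborel A * indicator B (f x) \<partial>lborel)"
      by (subst nn_integral_multc) (simp_all add: nn_integral_lborel_reflect[of "indicator A"])
    also have "\<dots> = emeasure lborel A * emeasure lborel (f -` B)"
      using vim[OF that(2)] by (subst nn_integral_cmult)
        (simp_all add: indicator_vimage[symmetric] o_def flip: nn_integral_indicator)
    finally show ?thesis .
  qed
  fix A :: "'a set" assume A: "A \<in> sets (distr lborel borel f)"
  let ?B = "cball 0 1 :: 'a set"
  have "f -` ?B = ?B" by (auto simp: nf)
  then have "emeasure lborel (f -` A) * emeasure lborel ?B = emeasure lborel A * emeasure lborel ?B"
    using cross[of A ?B] A by simp
  moreover have "emeasure lborel ?B \<noteq> 0" "emeasure lborel ?B \<noteq> \<top>"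
    using unit_ball_vol_pos[of "real DIM('a)", THEN less_imp_neq] by (simp_all add: emeasure_cball)
  ultimately have "emeasure lborel (f -` A) = emeasure lborel A"
    by (auto simp: mult.commute[of _ "emeasure lborel ?B"] ennreal_mult_cancel_left)
  then show "emeasure (distr lborel borel f) A = emeasure lborel A"
    using A by (simp add: emeasure_distr)
qed simp

lemma prod_Basis_vec:
  fixes z :: "'a::euclidean_space^'n"
  shows "(\<Prod>b\<in>Basis. z \<bullet> b) = (\<Prod>i\<in>UNIV. \<Prod>c\<in>Basis. z $ i \<bullet> c)"
proof -
  have bij: "bij_betw (\<lambda>(i, c). axis i c) (UNIV \<times> Basis) (Basis :: ('a^'n) set)"
    by (auto simp: bij_betw_def inj_on_def Basis_vec_def axis_eq_axis)
  have "(\<Prod>b\<in>Basis. z \<bullet> b) = (\<Prod>(i, c)\<in>UNIV \<times> Basis. z $ i \<bullet> c)"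
    unfolding prod.reindex_bij_betw[OF bij, symmetric] by (auto simp: inner_axis intro!: prod.cong)
  then show ?thesis by (simp add: prod.cartesian_product)
qed

lemma mem_box_vec:
  fixes l u x :: "'a::euclidean_space^'n"
  shows "x \<in> box l u \<longleftrightarrow> (\<forall>i. x $ i \<in> box (l $ i) (u $ i))"
  by (auto simp: mem_box Basis_vec_def inner_axis)

lemma matrix_of_entries_measurable [measurable]:
  "(\<lambda>f. \<chi> j k. f (j, k)) \<in> borel_measurable (Pi\<^sub>M UNIV (\<lambda>_. borel :: complex measure))"
  by (subst borel_measurable_euclidean_space) (auto simp: Basis_vec_def inner_axis)

lemma lborel_matrix:
  "(lborel :: (complex^'d^'d) measure)
    = distr (Pi\<^sub>M UNIV (\<lambda>_. lborel)) borel (\<lambda>f. \<chi> j k. f (j, k))"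
proof (rule lborel_eqI)
  fix l u :: "complex^'d^'d"
  assume le: "\<And>b. b \<in> Basis \<Longrightarrow> l \<bullet> b \<le> u \<bullet> b"
  interpret product_sigma_finite "\<lambda>_ :: 'd \<times> 'd. lborel :: complex measure" ..
  let ?F = "\<lambda>f :: 'd \<times> 'd \<Rightarrow> complex. \<chi> j k. f (j, k)"
  let ?B = "\<lambda>p. box (l $ fst p $ snd p) (u $ fst p $ snd p)"
  have m: "?F \<in> Pi\<^sub>M UNIV (\<lambda>_. lborel) \<rightarrow>\<^sub>M borel"
    using matrix_of_entries_measurable by (simp cong: measurable_cong_sets sets_PiM_cong)
  have le': "l $ j $ k \<bullet> c \<le> u $ j $ k \<bullet> c" if "c \<in> Basis" for j k c
    using le[of "axis j (axis k c)"] that by (auto simp: Basis_vec_def inner_axis)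
  have "emeasure (distr (Pi\<^sub>M UNIV (\<lambda>_. lborel)) borel ?F) (box l u)
      = emeasure (Pi\<^sub>M UNIV (\<lambda>_. lborel)) (?F -` box l u \<inter> space (Pi\<^sub>M UNIV (\<lambda>_. lborel)))"
    by (rule emeasure_distr[OF m]) simp
  also have "?F -` box l u \<inter> space (Pi\<^sub>M UNIV (\<lambda>_. lborel)) = Pi\<^sub>E UNIV ?B"
    by (auto simp: mem_box_vec space_PiM PiE_iff)
  also have "emeasure (Pi\<^sub>M UNIV (\<lambda>_. lborel)) \<dots> = (\<Prod>p\<in>UNIV. emeasure lborel (?B p))"
    by (rule emeasure_PiM) auto
  also have "\<dots> = (\<Prod>p\<in>UNIV. ennreal (\<Prod>c\<in>Basis. (u - l) $ fst p $ snd p \<bullet> c))"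
    using le' by (intro prod.cong refl) (simp add: emeasure_lborel_box)
  also have "\<dots> = ennreal (\<Prod>p\<in>UNIV. \<Prod>c\<in>Basis. (u - l) $ fst p $ snd p \<bullet> c)"
    using le' by (intro prod_ennreal prod_nonneg) (auto simp: inner_diff_left)
  also have "(\<Prod>p\<in>UNIV. \<Prod>c\<in>Basis. (u - l) $ fst p $ snd p \<bullet> c) = (\<Prod>b\<in>Basis. (u - l) \<bullet> b)"
    by (simp add: prod_Basis_vec prod.cartesian_product[where A = UNIV and B = UNIV] case_prod_beta)
  finally show "emeasure (distr (Pi\<^sub>M UNIV (\<lambda>_. lborel)) borel ?F) (box l u) = ennreal (\<Prod>b\<in>Basis. (u - l) \<bullet> b)" .
qed simp

lemma norm_matrix_power2: "(norm (H :: complex^'n^'m))\<^sup>2 = (\<Sum>j\<in>UNIV. \<Sum>k\<in>UNIV. (cmod (H $ j $ k))\<^sup>2)"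
  by (simp add: norm_vec_def L2_set_def sum_nonneg)

definition gaussian_matrix :: "(complex^'d^'d) measure" where
  "gaussian_matrix = density lborel (\<lambda>H. ennreal (exp (- (norm H)\<^sup>2) / pi ^ (CARD('d) * CARD('d))))"

lemma sets_gaussian_matrix [simp, measurable_cong]: "sets gaussian_matrix = sets borel"
  by (simp add: gaussian_matrix_def)

lemma space_gaussian_matrix [simp]: "space gaussian_matrix = UNIV"
  by (simp add: gaussian_matrix_def)

text \<open>Both measures have the same product values on rectangles.\<close>
lemma (in product_sigma_finite) PiM_density:
  assumes I: "finite I" and [measurable]: "\<And>i. i \<in> I \<Longrightarrow> f i \<in> borel_measurable (M i)"
    and sf: "\<And>i. sigma_finite_measure (density (M i) (f i))"
  shows "Pi\<^sub>M I (\<lambda>i. density (M i) (f i)) = density (Pi\<^sub>M I M) (\<lambda>x. \<Prod>i\<in>I. f i (x i))"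
proof (rule product_sigma_finite.PiM_eqI[symmetric, OF _ I])
  show "product_sigma_finite (\<lambda>i. density (M i) (f i))" by (intro product_sigma_finite.intro sf)
  show "sets (density (Pi\<^sub>M I M) (\<lambda>x. \<Prod>i\<in>I. f i (x i))) = sets (Pi\<^sub>M I (\<lambda>i. density (M i) (f i)))"
    by (simp cong: sets_PiM_cong)
  fix A assume "\<And>i. i \<in> I \<Longrightarrow> A i \<in> sets (density (M i) (f i))"
  then have A[measurable]: "\<And>i. i \<in> I \<Longrightarrow> A i \<in> sets (M i)" by simp
  have "emeasure (density (Pi\<^sub>M I M) (\<lambda>x. \<Prod>i\<in>I. f i (x i))) (Pi\<^sub>E I A)
      = (\<integral>\<^sup>+x. (\<Prod>i\<in>I. f i (x i)) * indicator (Pi\<^sub>E I A) x \<partial>Pi\<^sub>M I M)"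
    using I by (intro emeasure_density sets_PiM_I_finite) measurable
  also have "\<dots> = (\<integral>\<^sup>+x. (\<Prod>i\<in>I. f i (x i) * indicator (A i) (x i)) \<partial>Pi\<^sub>M I M)"
  proof (rule nn_integral_cong)
    fix x assume "x \<in> space (Pi\<^sub>M I M)"
    then have "indicator (Pi\<^sub>E I A) x = (\<Prod>i\<in>I. indicator (A i) (x i) :: ennreal)"
      using I by (auto simp: indicator_def space_PiM PiE_iff prod_zero_iff extensional_def)
    then show "(\<Prod>i\<in>I. f i (x i)) * indicator (Pi\<^sub>E I A) x = (\<Prod>i\<in>I. f i (x i) * indicator (A i) (x i))"
      by (simp add: prod.distrib)
  qed
  also have "\<dots> = (\<Prod>i\<in>I. \<integral>\<^sup>+x. f i x * indicator (A i) x \<partial>M i)"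
    by (rule product_nn_integral_prod[OF I]) measurable
  also have "\<dots> = (\<Prod>i\<in>I. emeasure (density (M i) (f i)) (A i))"
    by (intro prod.cong refl emeasure_density[symmetric]) auto
  finally show "emeasure (density (Pi\<^sub>M I M) (\<lambda>x. \<Prod>i\<in>I. f i (x i))) (Pi\<^sub>E I A)
    = (\<Prod>i\<in>I. emeasure (density (M i) (f i)) (A i))" .
qed

text \<open>
  The joint density of the entries is a function of \<open>norm H\<close> alone; this is the source of all
  invariance used below.
\<close>
lemma distr_gaussian_matrix:
  fixes H :: "'w \<Rightarrow> complex^'d^'d"
  assumes "prob_space M"
    and normal: "\<And>j k. std_complex_normal M (\<lambda>\<omega>. H \<omega> $ j $ k)"
    and indep: "prob_space.indep_vars M (\<lambda>_. borel) (\<lambda>(j, k) \<omega>. H \<omega> $ j $ k) UNIV"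
  shows "distr M borel H = gaussian_matrix"
proof -
  interpret prob_space M by fact
  let ?X = "\<lambda>p \<omega>. H \<omega> $ fst p $ snd p"
  let ?F = "\<lambda>f :: 'd \<times> 'd \<Rightarrow> complex. \<chi> j k. f (j, k)"
  let ?f = "\<lambda>z. ennreal (exp (- (cmod z)\<^sup>2) / pi)"
  let ?g = "\<lambda>H :: complex^'d^'d. ennreal (exp (- (norm H)\<^sup>2) / pi ^ (CARD('d) * CARD('d)))"
  interpret P: product_sigma_finite "\<lambda>_ :: 'd \<times> 'd. lborel :: complex measure" ..
  have X: "random_variable borel (?X p)" for p
    using normal[of "fst p" "snd p"] unfolding std_complex_normal_def
    by (auto dest: distributed_measurable)
  have dX: "distr M borel (?X p) = density lborel ?f" for p
    using distributed_distr_eq_density[OF normal[of "fst p" "snd p", unfolded std_complex_normal_def]]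
    by (simp cong: distr_cong)
  have sf: "sigma_finite_measure (density lborel ?f)"
    using prob_space_distr[OF X] unfolding dX
    by (meson finite_measure_def prob_space.finite_measure)
  have "distr M (Pi\<^sub>M UNIV (\<lambda>_. borel)) (\<lambda>\<omega>. \<lambda>p\<in>UNIV. ?X p \<omega>) = Pi\<^sub>M UNIV (\<lambda>p. distr M borel (?X p))"
    using indep_vars_iff_distr_eq_PiM'[of UNIV ?X "\<lambda>_. borel"] X indep
    by (simp add: case_prod_beta')
  also have "\<dots> = density (Pi\<^sub>M UNIV (\<lambda>_. lborel)) (\<lambda>x. \<Prod>p\<in>UNIV. ?f (x p))"
    unfolding dX by (rule P.PiM_density) (auto intro: sf)
  also have "(\<lambda>x. \<Prod>p\<in>UNIV. ?f (x p)) = (\<lambda>x. ?g (?F x))"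
  proof
    fix x :: "'d \<times> 'd \<Rightarrow> complex"
    have "(\<Prod>p\<in>UNIV. ?f (x p)) = ennreal (\<Prod>p\<in>UNIV. exp (- (cmod (x p))\<^sup>2) / pi)"
      by (rule prod_ennreal) simp
    also have "(\<Prod>p\<in>UNIV. exp (- (cmod (x p))\<^sup>2) / pi)
        = exp (- (\<Sum>p\<in>UNIV. (cmod (x p))\<^sup>2)) / pi ^ (CARD('d) * CARD('d))"
      by (simp add: prod_dividef exp_sum sum_negf[symmetric] card_prod)
    also have "(\<Sum>p\<in>UNIV. (cmod (x p))\<^sup>2) = (norm (?F x))\<^sup>2"
      by (simp add: norm_matrix_power2 sum.cartesian_product UNIV_Times_UNIV)
    finally show "(\<Prod>p\<in>UNIV. ?f (x p)) = ?g (?F x)" .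
  qed
  finally have *: "distr M (Pi\<^sub>M UNIV (\<lambda>_. borel)) (\<lambda>\<omega>. \<lambda>p\<in>UNIV. ?X p \<omega>)
    = density (Pi\<^sub>M UNIV (\<lambda>_. lborel)) (\<lambda>x. ?g (?F x))" .
  have m: "(\<lambda>\<omega>. \<lambda>p\<in>UNIV. ?X p \<omega>) \<in> M \<rightarrow>\<^sub>M Pi\<^sub>M UNIV (\<lambda>_. borel)"
    using X by (intro measurable_restrict) auto
  have "distr M borel H = distr M borel (?F \<circ> (\<lambda>\<omega>. \<lambda>p\<in>UNIV. ?X p \<omega>))"
    by (intro arg_cong[where f = "distr M borel"] ext) (simp add: vec_eq_iff)
  also have "\<dots> = distr (distr M (Pi\<^sub>M UNIV (\<lambda>_. borel)) (\<lambda>\<omega>. \<lambda>p\<in>UNIV. ?X p \<omega>)) borel ?F"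
    by (rule distr_distr[symmetric]) (auto intro: m)
  also have "\<dots> = distr (density (Pi\<^sub>M UNIV (\<lambda>_. lborel)) (\<lambda>x. ?g (?F x))) borel ?F"
    unfolding * ..
  also have "\<dots> = density (distr (Pi\<^sub>M UNIV (\<lambda>_. lborel)) borel ?F) ?g"
    by (rule density_distr[symmetric]) (use matrix_of_entries_measurable in
        \<open>auto cong: measurable_cong_sets sets_PiM_cong\<close>)
  finally show ?thesis by (simp add: lborel_matrix[symmetric] gaussian_matrix_def)
qed

lemma nn_integral_gaussian_matrix_orthogonal:
  fixes f :: "complex^'d^'d \<Rightarrow> complex^'d^'d"
  assumes f: "orthogonal_transformation f" and [measurable]: "h \<in> borel_measurable borel"
  shows "(\<integral>\<^sup>+H. h (f H) \<partial>gaussian_matrix) = (\<integral>\<^sup>+H. h H \<partial>gaussian_matrix)"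
proof -
  let ?g = "\<lambda>H :: complex^'d^'d. ennreal (exp (- (norm H)\<^sup>2) / pi ^ (CARD('d) * CARD('d)))"
  have lin: "linear f" and nf: "\<And>x. norm (f x) = norm x"
    using f by (auto simp: orthogonal_transformation)
  have [measurable]: "f \<in> borel_measurable borel"
    using lin by (intro borel_measurable_continuous_onI linear_continuous_on)
      (simp add: linear_conv_bounded_linear)
  have "(\<integral>\<^sup>+H. h H \<partial>gaussian_matrix) = (\<integral>\<^sup>+H. ?g H * h H \<partial>distr lborel borel f)"
    by (simp add: gaussian_matrix_def nn_integral_density lborel_orthogonal_transformation[OF f])
  also have "\<dots> = (\<integral>\<^sup>+H. ?g H * h (f H) \<partial>lborel)"
    by (subst nn_integral_distr) (simp_all add: nf)
  also have "\<dots> = (\<integral>\<^sup>+H. h (f H) \<partial>gaussian_matrix)"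
    by (simp add: gaussian_matrix_def nn_integral_density)
  finally show ?thesis ..
qed

text \<open>
  This replaces polar coordinates: the area of a disc is proportional to the square of its radius.
  The sign turns discs into preimages of the rays \<open>{x<..}\<close>, which generate the Borel sets and here
  have finite measure.
\<close>
lemma distr_neg_cmod_power2:
  "distr lborel borel (\<lambda>z. - (cmod z)\<^sup>2) = density lborel (\<lambda>u. ennreal pi * indicator {..0} u)"
proof (rule measure_eqI_lessThan)
  fix x :: real
  have pre: "(\<lambda>z. - (cmod z)\<^sup>2) -` {x<..} = ball 0 (sqrt (- x))" if "x \<le> 0"
  proof -
    have "cmod z < sqrt (- x) \<longleftrightarrow> x < - (cmod z)\<^sup>2" for z
    proof -
      have "cmod z < sqrt (- x) \<longleftrightarrow> sqrt ((cmod z)\<^sup>2) < sqrt (- x)" by simp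
      also have "\<dots> \<longleftrightarrow> (cmod z)\<^sup>2 < - x" by (rule real_sqrt_less_iff)
      finally show ?thesis by linarith
    qed
    then show ?thesis by auto
  qed
  have l: "emeasure (distr lborel borel (\<lambda>z. - (cmod z)\<^sup>2)) {x<..} = ennreal pi * ennreal (- x)"
  proof (cases "x \<le> 0")
    case True
    then show ?thesis
      by (simp add: emeasure_distr pre emeasure_ball unit_ball_vol_2 ennreal_mult'[symmetric])
  next
    case False
    have "\<not> x < - (cmod z)\<^sup>2" for z using False zero_le_power2[of "cmod z"] by linarith
    then have "(\<lambda>z. - (cmod z)\<^sup>2) -` {x<..} = {}" by auto
    then show ?thesis using False by (simp add: emeasure_distr ennreal_neg)
  qed
  have "emeasure (density lborel (\<lambda>u. ennreal pi * indicator {..0} u)) {x<..}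
      = (\<integral>\<^sup>+u. ennreal pi * indicator {x<..0} u \<partial>lborel)"
    by (subst emeasure_density) (auto intro!: nn_integral_cong simp: indicator_def)
  also have "\<dots> = ennreal pi * ennreal (- x)"
    by (subst nn_integral_cmult_indicator, simp, cases "x \<le> 0") (auto simp: ennreal_neg)
  finally show "emeasure (distr lborel borel (\<lambda>z. - (cmod z)\<^sup>2)) {x<..}
      = emeasure (density lborel (\<lambda>u. ennreal pi * indicator {..0} u)) {x<..}"
    using l by simp
  show "emeasure (distr lborel borel (\<lambda>z. - (cmod z)\<^sup>2)) {x<..} < \<infinity>"
    unfolding l by (simp add: ennreal_mult_less_top)
qed auto

lemma std_complex_normal_power2:
  assumes "prob_space M" "std_complex_normal M Z"
  shows "distributed M lborel (\<lambda>\<omega>. (cmod (Z \<omega>))\<^sup>2) (exponential_density 1)"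
proof -
  interpret prob_space M by fact
  note Z = assms(2)[unfolded std_complex_normal_def]
  have [measurable]: "Z \<in> borel_measurable M" using distributed_measurable[OF Z] by simp
  show ?thesis
  proof (subst exponential_distributed_iff, safe)
    fix a :: real assume a: "0 \<le> a"
    let ?h = "\<lambda>v. ennreal (exp v / pi) * indicator {- a..} v"
    have "emeasure M {\<omega> \<in> space M. (cmod (Z \<omega>))\<^sup>2 \<le> a} = (\<integral>\<^sup>+\<omega>. indicator {z. (cmod z)\<^sup>2 \<le> a} (Z \<omega>) \<partial>M)"
    proof -
      have "emeasure M {\<omega> \<in> space M. (cmod (Z \<omega>))\<^sup>2 \<le> a}
          = (\<integral>\<^sup>+\<omega>. indicator {\<omega> \<in> space M. (cmod (Z \<omega>))\<^sup>2 \<le> a} \<omega> \<partial>M)"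
        by (rule nn_integral_indicator[symmetric]) measurable
      also have "\<dots> = (\<integral>\<^sup>+\<omega>. indicator {z. (cmod z)\<^sup>2 \<le> a} (Z \<omega>) \<partial>M)"
        by (intro nn_integral_cong) (auto simp: indicator_def)
      finally show ?thesis .
    qed
    also have "\<dots> = (\<integral>\<^sup>+z. ennreal (exp (- (cmod z)\<^sup>2) / pi) * indicator {z. (cmod z)\<^sup>2 \<le> a} z \<partial>lborel)"
      by (rule distributed_nn_integral[OF Z, symmetric]) measurable
    also have "\<dots> = (\<integral>\<^sup>+z. ?h (- (cmod z)\<^sup>2) \<partial>lborel)"
      by (intro nn_integral_cong) (auto simp: indicator_def)
    also have "\<dots> = (\<integral>\<^sup>+v. ?h v \<partial>distr lborel borel (\<lambda>z. - (cmod z)\<^sup>2))"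
      by (rule nn_integral_distr[symmetric]) measurable
    also have "\<dots> = (\<integral>\<^sup>+v. ennreal (exp v) * indicator {- a..0} v \<partial>lborel)"
      unfolding distr_neg_cmod_power2
      by (subst nn_integral_density) (auto intro!: nn_integral_cong simp: indicator_def ennreal_mult[symmetric])
    also have "\<dots> = ennreal (exp 0 - exp (- a))"
      using a by (intro nn_integral_FTC_Icc) (auto intro!: derivative_eq_intros)
    finally show "\<P>(\<omega> in M. (cmod (Z \<omega>))\<^sup>2 \<le> a) = 1 - exp (- a * 1)"
      using a by (simp add: emeasure_eq_measure)
  qed auto
qed


section \<open>Sums of independent exponential variables\<close>
definition hypoexponential_density :: "'a set \<Rightarrow> ('a \<Rightarrow> real) \<Rightarrow> real \<Rightarrow> real" where
  "hypoexponential_density I y x = (\<Sum>j\<in>I. lagrange_weight I y j * exponential_density (y j) x)"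

lemma hypoexponential_density_measurable [measurable]:
  "hypoexponential_density I y \<in> borel_measurable borel"
  unfolding hypoexponential_density_def[abs_def] by measurable

lemma lagrange_weight_insert:
  assumes "finite I" "k \<notin> I" "j \<in> I"
  shows "lagrange_weight (insert k I) y j = lagrange_weight I y j * (y k / (y k - y j))"
proof -
  have "insert k I - {j} = insert k (I - {j})" using assms by auto
  then show ?thesis using assms by (simp add: lagrange_weight_def)
qed

text \<open>
  The weight of the new node \<open>k\<close> is eliminated with \<open>lagrange_at_zero\<close>, applied to the polynomial
  \<open>x\<close>: it says that the weighted sum of all rates vanishes as soon as there are two of them.
\<close>
lemma hypoexponential_density_insert:
  assumes I: "finite I" "I \<noteq> {}" "k \<notin> I" "inj_on y (insert k I)" and x: "0 \<le> x"
  shows "hypoexponential_density (insert k I) y x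
    = (\<Sum>j\<in>I. lagrange_weight (insert k I) y j * y j * (exp (- (y j * x)) - exp (- (y k * x))))"
proof -
  let ?w = "lagrange_weight (insert k I) y"
  have "degree [:0, 1 :: real:] < card (insert k I)"
    using I by (simp add: card_gt_0_iff)
  then have "(\<Sum>j\<in>insert k I. poly [:0, 1:] (y j) * ?w j) = poly [:0, 1:] 0"
    using I by (intro lagrange_at_zero) auto
  then have "y k * ?w k = - (\<Sum>j\<in>I. ?w j * y j)"
    using I by (simp add: mult.commute eq_neg_iff_add_eq_0)
  then have "hypoexponential_density (insert k I) y x
    = - (\<Sum>j\<in>I. ?w j * y j) * exp (- (y k * x)) + (\<Sum>j\<in>I. ?w j * (y j * exp (- (y j * x))))"
    using I x by (simp add: hypoexponential_density_def exponential_density_def mult_ac)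
      (metis mult.assoc mult.commute mult_minus_left)
  also have "\<dots> = (\<Sum>j\<in>I. ?w j * y j * (exp (- (y j * x)) - exp (- (y k * x))))"
    by (simp add: right_diff_distrib sum_subtractf sum_distrib_left sum_distrib_right mult_ac)
  finally show ?thesis .
qed

text \<open>
  Nonnegativity is not visible from the formula, since the weights alternate in sign. It is
  obtained inductively along with the convolution identity, as the convolution integral has a
  nonnegative integrand.
\<close>
lemma hypoexponential_density_convolution:
  assumes I: "finite I" "I \<noteq> {}" "k \<notin> I" "inj_on y (insert k I)" and y: "\<And>i. i \<in> insert k I \<Longrightarrow> 0 < y i"
    and nonneg: "\<And>x. 0 \<le> hypoexponential_density I y x"
  shows "0 \<le> hypoexponential_density (insert k I) y x"
    and "(\<integral>\<^sup>+u. ennreal (exponential_density (y k) (x - u)) * ennreal (hypoexponential_density I y u) \<partial>lborel)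
      = ennreal (hypoexponential_density (insert k I) y x)"
proof -
  let ?w = "lagrange_weight (insert k I) y"
  let ?f = "\<lambda>u. y k * exp (- (y k * (x - u))) * (\<Sum>j\<in>I. lagrange_weight I y j * (y j * exp (- (y j * u))))"
  let ?F = "\<lambda>u. \<Sum>j\<in>I. ?w j * y j * exp (- (y k * x) + (y k - y j) * u)"
  have pos: "0 \<le> hypoexponential_density (insert k I) y x \<and>
    (\<integral>\<^sup>+u. ennreal (?f u) * indicator {0..x} u \<partial>lborel) = ennreal (hypoexponential_density (insert k I) y x)"
    if x: "0 \<le> x"
  proof -
    have f: "?f u = y k * exp (- (y k * (x - u))) * hypoexponential_density I y u" if "0 \<le> u" for u
      using that by (simp add: hypoexponential_density_def exponential_density_def mult_ac)
    have f0: "0 \<le> ?f u" if "0 \<le> u" for u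
      unfolding f[OF that] using nonneg[of u] y[of k] by simp
    have deriv: "(?F has_real_derivative ?f u) (at u)" for u
    proof -
      have "(?F has_real_derivative (\<Sum>j\<in>I. ?w j * y j * (exp (- (y k * x) + (y k - y j) * u) * (y k - y j)))) (at u)"
        by (auto intro!: derivative_eq_intros sum.cong)
      also have "(\<Sum>j\<in>I. ?w j * y j * (exp (- (y k * x) + (y k - y j) * u) * (y k - y j))) = ?f u"
        unfolding sum_distrib_left
      proof (rule sum.cong[OF refl])
        fix j assume j: "j \<in> I"
        then have "y k - y j \<noteq> 0" using I by (auto dest: inj_onD)
        then have "?w j * (y k - y j) = lagrange_weight I y j * y k"
          using lagrange_weight_insert[OF I(1,3) j, of y] by simp
        moreover have "exp (- (y k * x) + (y k - y j) * u) = exp (- (y k * (x - u))) * exp (- (y j * u))"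
          by (simp add: mult_exp_exp algebra_simps)
        ultimately show "?w j * y j * (exp (- (y k * x) + (y k - y j) * u) * (y k - y j))
          = y k * exp (- (y k * (x - u))) * (lagrange_weight I y j * (y j * exp (- (y j * u))))"
          by (simp add: mult_ac)
      qed
      finally show ?thesis .
    qed
    have diff: "?F x - ?F 0 = hypoexponential_density (insert k I) y x"
      unfolding hypoexponential_density_insert[OF I x]
      by (simp add: right_diff_distrib left_diff_distrib sum_subtractf algebra_simps)
    have "?F 0 \<le> ?F x"
      by (rule DERIV_nonneg_imp_nondecreasing[OF x]) (use deriv f0 in blast)
    moreover have "(\<integral>\<^sup>+u. ennreal (?f u) * indicator {0..x} u \<partial>lborel) = ennreal (?F x - ?F 0)"
      by (rule nn_integral_FTC_Icc[OF _ deriv f0 x]) auto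
    ultimately show ?thesis using diff by simp
  qed
  have neg: "hypoexponential_density (insert k I) y x = 0" if "x < 0"
    using that by (simp add: hypoexponential_density_def exponential_density_def)
  show "0 \<le> hypoexponential_density (insert k I) y x"
    using pos neg by (cases "0 \<le> x") auto
  have "(\<integral>\<^sup>+u. ennreal (exponential_density (y k) (x - u)) * ennreal (hypoexponential_density I y u) \<partial>lborel)
      = (\<integral>\<^sup>+u. ennreal (?f u) * indicator {0..x} u \<partial>lborel)"
    using y[of k] nonneg
    by (intro nn_integral_cong) (auto simp: indicator_def hypoexponential_density_def exponential_density_def
        ennreal_mult[symmetric] algebra_simps)
  also have "\<dots> = ennreal (hypoexponential_density (insert k I) y x)"
    using pos neg by (cases "0 \<le> x") (auto simp: indicator_def)
  finally show "(\<integral>\<^sup>+u. ennreal (exponential_density (y k) (x - u)) * ennreal (hypoexponential_density I y u) \<partial>lborel)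
      = ennreal (hypoexponential_density (insert k I) y x)" .
qed

lemma (in prob_space) hypoexponential_distributed:
  assumes "finite I" "I \<noteq> {}" "inj_on y I" "\<And>i. i \<in> I \<Longrightarrow> 0 < y i"
    and "\<And>i. i \<in> I \<Longrightarrow> distributed M lborel (X i) (exponential_density (y i))"
    and "indep_vars (\<lambda>_. borel) X I"
  shows "(\<forall>x. 0 \<le> hypoexponential_density I y x) \<and>
    distributed M lborel (\<lambda>\<omega>. \<Sum>i\<in>I. X i \<omega>) (hypoexponential_density I y)"
  using assms
proof (induction rule: finite_ne_induct)
  case (singleton k)
  have "hypoexponential_density {k} y = exponential_density (y k)"
    by (simp add: fun_eq_iff hypoexponential_density_def lagrange_weight_def)
  then show ?case using singleton by (simp add: exponential_density_nonneg)
next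
  case (insert k I)
  have IH: "\<forall>x. 0 \<le> hypoexponential_density I y x"
    "distributed M lborel (\<lambda>\<omega>. \<Sum>i\<in>I. X i \<omega>) (hypoexponential_density I y)"
    using insert by (auto intro: indep_vars_subset inj_on_subset)
  note conv = hypoexponential_density_convolution[OF insert(1,2,3) insert.prems(1) insert.prems(2) IH(1)[rule_format]]
  have "distributed M lborel (\<lambda>\<omega>. X k \<omega> + (\<Sum>i\<in>I. X i \<omega>))
    (\<lambda>x. \<integral>\<^sup>+u. ennreal (exponential_density (y k) (x - u)) * ennreal (hypoexponential_density I y u) \<partial>lborel)"
    by (rule distributed_convolution[OF indep_vars_sum[OF insert(1,3)] _ IH(2)]) (use insert in auto)
  then show ?case using insert(1,3) conv by simp
qed

lemma exponential_moment:
  assumes s: "-1 < s" and y: "0 < y"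
  shows "has_bochner_integral lborel (\<lambda>x. x powr s * exponential_density y x) (Gamma (1 + s) * y powr (- s))"
proof (rule has_bochner_integral_nn_integral)
  let ?g = "\<lambda>t. indicator {0..} t * t powr s / exp t"
  have "ennreal (Gamma (1 + s)) = (\<integral>\<^sup>+t. ennreal (?g t) \<partial>lborel)"
    using Gamma_conv_nn_integral_real[of "1 + s"] s by simp
  also have "\<dots> = ennreal y * (\<integral>\<^sup>+x. ennreal (?g (0 + y * x)) \<partial>lborel)"
    using y by (subst nn_integral_real_affine[where c = y and t = 0]) auto
  also have "\<dots> = (\<integral>\<^sup>+x. ennreal y * ennreal (?g (0 + y * x)) \<partial>lborel)"
    by (rule nn_integral_cmult[symmetric]) simp
  finally have G: "ennreal (Gamma (1 + s)) = (\<integral>\<^sup>+x. ennreal y * ennreal (?g (0 + y * x)) \<partial>lborel)" .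
  have "(\<integral>\<^sup>+x. ennreal (x powr s * exponential_density y x) \<partial>lborel)
      = (\<integral>\<^sup>+x. ennreal (y powr (- s)) * (ennreal y * ennreal (?g (0 + y * x))) \<partial>lborel)"
  proof (rule nn_integral_cong)
    fix x :: real
    have "x powr s * exponential_density y x = y powr (- s) * (y * ?g (0 + y * x))"
    proof (cases "x < 0")
      case True then show ?thesis using y by (simp add: exponential_density_def mult_less_0_iff not_le zero_le_mult_iff indicator_def)
    next
      case False
      then have "(y * x) powr s = y powr s * x powr s" using y by (simp add: powr_mult)
      moreover have "y powr (- s) * y powr s = 1" using y by (simp flip: powr_add)
      ultimately have "x powr s = y powr (- s) * (y * x) powr s" by (metis mult.assoc mult_1)
      then show ?thesis using False y
        by (simp add: exponential_density_def indicator_def exp_minus field_simps)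
    qed
    then show "ennreal (x powr s * exponential_density y x)
        = ennreal (y powr (- s)) * (ennreal y * ennreal (?g (0 + y * x)))"
      using y by (simp add: ennreal_mult[symmetric] indicator_def)
  qed
  also have "\<dots> = ennreal (y powr (- s)) * ennreal (Gamma (1 + s))"
    unfolding G by (rule nn_integral_cmult) simp
  finally show "(\<integral>\<^sup>+x. ennreal (x powr s * exponential_density y x) \<partial>lborel)
    = ennreal (Gamma (1 + s) * y powr (- s))"
    using s by (simp add: ennreal_mult[symmetric] Gamma_real_pos less_imp_le mult.commute)
qed (use s y in \<open>auto simp: Gamma_real_pos less_imp_le exponential_density_nonneg\<close>)

lemma (in prob_space) hypoexponential_moment:
  assumes I: "finite I" "I \<noteq> {}" "inj_on y I" and y: "\<And>i. i \<in> I \<Longrightarrow> 0 < y i"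
    and X: "\<And>i. i \<in> I \<Longrightarrow> distributed M lborel (X i) (exponential_density (y i))"
    and indep: "indep_vars (\<lambda>_. borel) X I" and s: "-1 < s"
  shows "(\<integral>\<^sup>+\<omega>. ennreal ((\<Sum>i\<in>I. X i \<omega>) powr s) \<partial>M)
    = ennreal (Gamma (1 + s) * (\<Sum>j\<in>I. y j powr (- s) * lagrange_weight I y j))"
proof -
  have nonneg: "\<And>x. 0 \<le> hypoexponential_density I y x"
    and dist: "distributed M lborel (\<lambda>\<omega>. \<Sum>i\<in>I. X i \<omega>) (hypoexponential_density I y)"
    using hypoexponential_distributed[OF I y X indep] by auto
  have hb: "has_bochner_integral lborel (\<lambda>x. x powr s * hypoexponential_density I y x)
     (\<Sum>j\<in>I. lagrange_weight I y j * (Gamma (1 + s) * y j powr (- s)))"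
  proof -
    have "has_bochner_integral lborel (\<lambda>x. \<Sum>j\<in>I. lagrange_weight I y j * (x powr s * exponential_density (y j) x))
       (\<Sum>j\<in>I. lagrange_weight I y j * (Gamma (1 + s) * y j powr (- s)))"
      using s y by (intro has_bochner_integral_sum has_bochner_integral_mult_right exponential_moment) auto
    then show ?thesis by (simp add: hypoexponential_density_def sum_distrib_left mult_ac)
  qed
  have "(\<integral>\<^sup>+\<omega>. ennreal ((\<Sum>i\<in>I. X i \<omega>) powr s) \<partial>M)
      = (\<integral>\<^sup>+x. ennreal (hypoexponential_density I y x) * ennreal (x powr s) \<partial>lborel)"
    by (rule distributed_nn_integral[OF dist, symmetric]) simp
  also have "\<dots> = (\<integral>\<^sup>+x. ennreal (x powr s * hypoexponential_density I y x) \<partial>lborel)"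
    using nonneg by (simp add: ennreal_mult[symmetric] mult.commute)
  also have "\<dots> = ennreal (\<integral>x. x powr s * hypoexponential_density I y x \<partial>lborel)"
    using hb nonneg by (intro nn_integral_eq_integral) (auto simp: has_bochner_integral_iff)
  also have "(\<integral>x. x powr s * hypoexponential_density I y x \<partial>lborel)
      = Gamma (1 + s) * (\<Sum>j\<in>I. y j powr (- s) * lagrange_weight I y j)"
    using hb by (simp add: has_bochner_integral_iff sum_distrib_left mult_ac)
  finally show ?thesis .
qed


section \<open>Moments of a Gaussian matrix and the matrix norm\<close>
lemma borel_measurable_component [measurable (raw)]:
  fixes f :: "'a \<Rightarrow> ('b::topological_space)^'n"
  assumes "f \<in> borel_measurable M"
  shows "(\<lambda>x. f x $ i) \<in> borel_measurable M"
  by (rule borel_measurable_continuous_on[OF _ assms]) (intro continuous_intros)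

lemma borel_measurable_vectorI:
  fixes f :: "'a \<Rightarrow> ('b::euclidean_space)^'n"
  assumes "\<And>i. (\<lambda>x. f x $ i) \<in> borel_measurable M"
  shows "f \<in> borel_measurable M"
  using assms by (subst borel_measurable_euclidean_space) (auto simp: Basis_vec_def inner_axis)

lemma borel_measurable_matrix_mult [measurable (raw)]:
  fixes f g :: "'a \<Rightarrow> complex^'n^'n"
  assumes [measurable]: "f \<in> borel_measurable M" "g \<in> borel_measurable M"
  shows "(\<lambda>x. f x ** g x) \<in> borel_measurable M"
  by (intro borel_measurable_vectorI) (simp add: matrix_matrix_mult_def)

lemma borel_measurable_matrix_vector_mult [measurable (raw)]:
  fixes f :: "'a \<Rightarrow> complex^'n^'n" and g :: "'a \<Rightarrow> complex^'n"
  assumes [measurable]: "f \<in> borel_measurable M" "g \<in> borel_measurable M"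
  shows "(\<lambda>x. f x *v g x) \<in> borel_measurable M"
  by (intro borel_measurable_vectorI) (simp add: matrix_vector_mult_def)

lemma norm_matrix_columns: "(norm (H :: complex^'n^'n))\<^sup>2 = (\<Sum>k\<in>UNIV. (norm (H *v axis k 1))\<^sup>2)"
proof -
  have "(norm (H *v axis k 1))\<^sup>2 = (\<Sum>j\<in>UNIV. (cmod (H $ j $ k))\<^sup>2)" for k
    by (simp add: norm_vec_def L2_set_def sum_nonneg matrix_vector_mult_def axis_def mult_delta_right)
  then show ?thesis unfolding norm_matrix_power2 by (subst sum.swap) simp
qed

lemma norm_transpose: "norm (transpose (H :: complex^'n^'n)) = norm H"
proof -
  have "(norm (transpose H))\<^sup>2 = (norm H)\<^sup>2"
    unfolding norm_matrix_power2 transpose_def vec_lambda_beta by (rule sum.swap)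
  then show ?thesis by simp
qed

lemma norm_unitary_mult:
  fixes U H :: "complex^'d^'d"
  assumes "unitary_matrix U" shows "norm (U ** H) = norm H"
proof -
  have "norm ((U ** H) *v axis k 1) = norm (H *v axis k 1)" for k
    using unitary_norm[OF assms, of "H *v axis k 1"] by (simp add: matrix_vector_mul_assoc)
  then have "(norm (U ** H))\<^sup>2 = (norm H)\<^sup>2"
    by (simp only: norm_matrix_columns)
  then show ?thesis by simp
qed

lemma unitary_transpose: assumes "unitary_matrix U" shows "unitary_matrix (transpose U)"
proof -
  have "(conj_transpose (transpose U) ** transpose U) $ i $ j = (U ** conj_transpose U) $ j $ i" for i j
    by (simp add: matrix_matrix_mult_def conj_transpose_def transpose_def mult.commute)
  then have "(conj_transpose (transpose U) ** transpose U) $ i $ j = mat 1 $ i $ j" for i j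
    by (auto simp: unitary_conj_transpose(2)[OF assms] mat_def)
  then show ?thesis by (simp add: unitary_matrix_def vec_eq_iff)
qed

lemma norm_mult_unitary:
  fixes U H :: "complex^'d^'d"
  assumes "unitary_matrix U" shows "norm (H ** U) = norm H"
proof -
  have "norm (H ** U) = norm (transpose U ** transpose H)"
    by (simp only: norm_transpose matrix_transpose_mul[symmetric])
  also have "\<dots> = norm H"
    by (simp add: norm_unitary_mult[OF unitary_transpose[OF assms]] norm_transpose)
  finally show ?thesis .
qed

lemma orthogonal_transformation_unitary:
  fixes U :: "complex^'d^'d"
  assumes "unitary_matrix U"
  shows "orthogonal_transformation ((**) U :: complex^'d^'d \<Rightarrow> _)"
    "orthogonal_transformation (\<lambda>H :: complex^'d^'d. H ** U)"
proof -
  have "linear ((**) U :: complex^'d^'d \<Rightarrow> _)" "linear (\<lambda>H :: complex^'d^'d. H ** U)"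
    by (auto intro!: linearI simp: vec_eq_iff matrix_matrix_mult_def distrib_left distrib_right
        sum.distrib scaleR_sum_right)
  then show "orthogonal_transformation ((**) U :: complex^'d^'d \<Rightarrow> _)"
    "orthogonal_transformation (\<lambda>H :: complex^'d^'d. H ** U)"
    using norm_unitary_mult[OF assms] norm_mult_unitary[OF assms]
    unfolding orthogonal_transformation by auto
qed

lemma powr_of_power2: "0 \<le> x \<Longrightarrow> (x\<^sup>2) powr (q / 2) = x powr q" for x q :: real
  by (cases "x = 0") (simp_all add: powr_powr flip: powr_numeral)

text \<open>
  By invariance these moments do not depend on the choice of the column \<open>a\<close>, which is kept as a
  parameter only to have a concrete vector \<open>axis a 1\<close> at hand.
\<close>
definition column_moment :: "'d::finite \<Rightarrow> real \<Rightarrow> real^'d \<Rightarrow> ennreal" where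
  "column_moment a q y =
    (\<integral>\<^sup>+H. ennreal ((\<Sum>j\<in>UNIV. (cmod (H $ j $ a))\<^sup>2 / y $ j) powr (q / 2)) \<partial>gaussian_matrix)"

definition entry_moment :: "'d::finite \<Rightarrow> real \<Rightarrow> ennreal" where
  "entry_moment a q = (\<integral>\<^sup>+H. ennreal (cmod (H $ a $ a) powr q) \<partial>(gaussian_matrix :: (complex^'d::finite^'d::finite) measure))"

lemma matrix_vector_scaleR: "A *v (c *\<^sub>R x) = c *\<^sub>R (A *v (x :: complex^'d))"
  by (simp add: vec_eq_iff matrix_vector_mult_def scaleR_sum_right)

text \<open>
  Right multiplication by a unitary matrix moves \<open>v\<close> to a multiple of a basis vector; left
  multiplication by \<open>U\<close> then diagonalises the quadratic form. The identity also holds for \<open>v = 0\<close>,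
  where both sides vanish because \<open>0 powr q = 0\<close> for every \<open>q\<close>.
\<close>
lemma norm_moment:
  fixes U :: "complex^'d^'d"
  assumes U: "unitary_matrix U" and y: "\<And>j. 0 < y $ j"
  shows "(\<integral>\<^sup>+H. ennreal (norm (pos_def_sqrt (unitary_diag U (\<chi> j. 1 / y $ j)) ** H *v v) powr q) \<partial>gaussian_matrix)
    = column_moment a q y * ennreal (norm v powr q)"
proof (cases "v = 0")
  case True
  then show ?thesis by (simp add: matrix_vector_mult_0_right)
next
  case False
  let ?R = "pos_def_sqrt (unitary_diag U (\<chi> j. 1 / y $ j))"
  have "norm ((1 / norm v) *\<^sub>R v) = 1" using False by simp
  then obtain V where V: "unitary_matrix V" "V *v axis a 1 = (1 / norm v) *\<^sub>R v"
    by (rule unitary_with_column)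
  have v: "v = norm v *\<^sub>R (V *v axis a 1)" using False V by simp
  let ?h = "\<lambda>H. ennreal (norm (?R *v (H *v axis a 1)) powr q)"
  have "norm (?R ** H *v v) = norm v * norm (?R *v ((H ** V) *v axis a 1))" for H
    by (subst (1) v) (simp add: matrix_vector_scaleR matrix_vector_mul_assoc matrix_mul_assoc)
  then have "(\<integral>\<^sup>+H. ennreal (norm (?R ** H *v v) powr q) \<partial>gaussian_matrix)
      = (\<integral>\<^sup>+H. ennreal (norm v powr q) * ?h (H ** V) \<partial>gaussian_matrix)"
    by (simp add: powr_mult ennreal_mult[symmetric])
  also have "\<dots> = ennreal (norm v powr q) * (\<integral>\<^sup>+H. ?h (H ** V) \<partial>gaussian_matrix)"
    by (rule nn_integral_cmult) measurable
  also have "(\<integral>\<^sup>+H. ?h (H ** V) \<partial>gaussian_matrix) = (\<integral>\<^sup>+H. ?h H \<partial>gaussian_matrix)"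
    by (rule nn_integral_gaussian_matrix_orthogonal[OF orthogonal_transformation_unitary(2)[OF V(1)]]) measurable
  also have "\<dots> = (\<integral>\<^sup>+H. ?h (U ** H) \<partial>gaussian_matrix)"
    by (rule nn_integral_gaussian_matrix_orthogonal[OF orthogonal_transformation_unitary(1)[OF U], symmetric]) measurable
  also have "\<dots> = column_moment a q y"
    unfolding column_moment_def
  proof (intro nn_integral_cong arg_cong[where f = ennreal])
    fix H :: "complex^'d^'d"
    have "conj_transpose U *v ((U ** H) *v axis a 1) = H *v axis a 1"
      using U by (simp add: matrix_vector_mul_assoc matrix_mul_assoc unitary_matrix_def)
    then have "(norm (?R *v ((U ** H) *v axis a 1)))\<^sup>2 = (\<Sum>j\<in>UNIV. (cmod (H $ j $ a))\<^sup>2 / y $ j)"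
      using y by (subst norm_pos_def_sqrt_mult[OF U])
        (simp_all add: matrix_vector_mult_def axis_def mult_delta_right)
    then show "norm (?R *v ((U ** H) *v axis a 1)) powr q
        = (\<Sum>j\<in>UNIV. (cmod (H $ j $ a))\<^sup>2 / y $ j) powr (q / 2)"
      using powr_of_power2[of "norm (?R *v ((U ** H) *v axis a 1))" q] by simp
  qed
  finally show ?thesis by (simp add: mult.commute)
qed

text \<open>Rotating the row \<open>r\<close> to a multiple of a basis vector reduces the sum to a single entry.\<close>
lemma row_moment:
  fixes r :: "complex^'d"
  assumes r: "r \<noteq> 0"
  shows "(\<integral>\<^sup>+H. ennreal (cmod (\<Sum>k\<in>UNIV. r $ k * H $ k $ a) powr q) \<partial>gaussian_matrix)
    = entry_moment a q * ennreal (norm r powr q)"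
proof -
  define x where "x = (1 / norm r) *\<^sub>R (\<chi> k. cnj (r $ k))"
  have "norm (\<chi> k. cnj (r $ k)) = norm r" by (simp add: norm_vec_def)
  then have "norm x = 1" using r by (simp add: x_def)
  then obtain V where V: "unitary_matrix V" "V *v axis a 1 = x" by (rule unitary_with_column)
  note U = unitary_conj_transpose(1)[OF V(1)]
  have "V $ k $ a = x $ k" for k
    using V(2) by (auto simp: vec_eq_iff matrix_vector_mult_def axis_def mult_delta_right)
  then have row: "r $ k = norm r * conj_transpose V $ a $ k" for k
    using r by (simp add: conj_transpose_def x_def scaleR_conv_of_real[where 'a=complex])
  have "cmod (\<Sum>k\<in>UNIV. r $ k * H $ k $ a) = norm r * cmod ((conj_transpose V ** H) $ a $ a)" for H :: "complex^'d^'d"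
    unfolding row by (simp add: matrix_matrix_mult_def mult.assoc norm_mult flip: sum_distrib_left)
  then have "(\<integral>\<^sup>+H. ennreal (cmod (\<Sum>k\<in>UNIV. r $ k * H $ k $ a) powr q) \<partial>gaussian_matrix)
    = (\<integral>\<^sup>+H. ennreal (norm r powr q) * ennreal (cmod ((conj_transpose V ** H) $ a $ a) powr q) \<partial>gaussian_matrix)"
    by (simp add: powr_mult ennreal_mult[symmetric])
  also have "\<dots> = ennreal (norm r powr q) * (\<integral>\<^sup>+H. ennreal (cmod ((conj_transpose V ** H) $ a $ a) powr q) \<partial>gaussian_matrix)"
    by (rule nn_integral_cmult) measurable
  also have "(\<integral>\<^sup>+H. ennreal (cmod ((conj_transpose V ** H) $ a $ a) powr q) \<partial>gaussian_matrix) = entry_moment a q"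
    unfolding entry_moment_def
    by (rule nn_integral_gaussian_matrix_orthogonal[OF orthogonal_transformation_unitary(1)[OF U],
        where h = "\<lambda>H. ennreal (cmod (H $ a $ a) powr q)"]) measurable
  finally show ?thesis by (simp add: mult.commute)
qed

text \<open>
  If the parameters change by factors between \<open>exp (- d)\<close> and \<open>exp d\<close>, so does the quadratic form,
  and its power changes by at most \<open>exp (\<bar>q\<bar> / 2 * d)\<close>. This one estimate gives both the
  continuity of the moments and their finiteness for coinciding parameters.
\<close>
lemma column_moment_compare:
  fixes y z :: "real^'d"
  assumes y: "\<And>j. 0 < y $ j" and z: "\<And>j. 0 < z $ j"
  shows "column_moment a q z
    \<le> ennreal (exp (\<bar>q\<bar> / 2 * (\<Sum>j\<in>UNIV. \<bar>ln (z $ j) - ln (y $ j)\<bar>))) * column_moment a q y"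
proof -
  let ?d = "\<Sum>j\<in>UNIV. \<bar>ln (z $ j) - ln (y $ j)\<bar>"
  have le: "\<bar>ln (z $ j) - ln (y $ j)\<bar> \<le> ?d" for j
    by (rule member_le_sum) auto
  let ?X = "\<lambda>y H. \<Sum>j\<in>UNIV. (cmod (H $ j $ a))\<^sup>2 / y $ j"
  have cmp: "?X u H \<le> exp ?d * ?X v H"
    if u: "\<And>j. 0 < u $ j" and v: "\<And>j. 0 < v $ j" and uv: "\<And>j. ln (v $ j) - ln (u $ j) \<le> ?d"
    for u v :: "real^'d" and H :: "complex^'d^'d"
    unfolding sum_distrib_left
  proof (rule sum_mono)
    fix j
    have "v $ j / u $ j = exp (ln (v $ j) - ln (u $ j))" using u v by (simp add: exp_diff)
    also have "\<dots> \<le> exp ?d" using uv by simp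
    finally have "1 / u $ j \<le> exp ?d * (1 / v $ j)" using u[of j] v[of j] by (simp add: field_simps)
    then show "(cmod (H $ j $ a))\<^sup>2 / u $ j \<le> exp ?d * ((cmod (H $ j $ a))\<^sup>2 / v $ j)"
      using mult_left_mono[of "1 / u $ j" "exp ?d * (1 / v $ j)" "(cmod (H $ j $ a))\<^sup>2"] by (simp add: mult_ac)
  qed
  have nn: "0 \<le> ?X y H" "0 \<le> ?X z H" for H :: "complex^'d^'d"
    using y z by (auto intro!: sum_nonneg divide_nonneg_nonneg dest: less_imp_le)
  have yz: "?X y H \<le> exp ?d * ?X z H" and zy: "?X z H \<le> exp ?d * ?X y H" for H :: "complex^'d^'d"
    using le y z by (auto intro!: cmp simp: abs_le_iff)
  have "?X z H powr (q / 2) \<le> exp (\<bar>q\<bar> / 2 * ?d) * ?X y H powr (q / 2)" for H :: "complex^'d^'d"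
  proof (cases "0 \<le> q")
    case True
    have "?X z H powr (q / 2) \<le> (exp ?d * ?X y H) powr (q / 2)"
      using True nn zy by (intro powr_mono2) auto
    also have "\<dots> = exp (\<bar>q\<bar> / 2 * ?d) * ?X y H powr (q / 2)"
      by (subst powr_mult) (use True nn[of H] in \<open>auto simp: powr_def[of "exp _"] mult.commute\<close>)
    finally show ?thesis .
  next
    case False
    show ?thesis
    proof (cases "?X y H = 0")
      case True
      with zy[of H] nn[of H] have "?X z H = 0" by simp
      then show ?thesis by simp
    next
      case pos: False
      then have "0 < ?X y H" using nn[of H] by simp
      have "?X z H powr (q / 2) \<le> (exp (- ?d) * ?X y H) powr (q / 2)"
        using False \<open>0 < ?X y H\<close> yz[of H] by (intro powr_mono2') (auto simp: exp_minus field_simps)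
      also have "\<dots> = exp (\<bar>q\<bar> / 2 * ?d) * ?X y H powr (q / 2)"
          by (subst powr_mult) (use False nn[of H] in \<open>auto simp: powr_def[of "exp _"] mult.commute\<close>)
      finally show ?thesis .
    qed
  qed
  then have "column_moment a q z
      \<le> (\<integral>\<^sup>+H. ennreal (exp (\<bar>q\<bar> / 2 * ?d)) * ennreal (?X y H powr (q / 2)) \<partial>gaussian_matrix)"
    unfolding column_moment_def by (intro nn_integral_mono) (simp add: ennreal_mult[symmetric])
  also have "\<dots> = ennreal (exp (\<bar>q\<bar> / 2 * ?d)) * column_moment a q y"
    unfolding column_moment_def by (rule nn_integral_cmult) measurable
  finally show ?thesis .
qed

lemma norm_matrix_vector_le: "norm (P *v x) \<le> norm (P :: complex^'d^'d) * norm x"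
proof -
  have "norm ((P *v x) $ i) \<le> norm (P $ i) * norm x" for i
  proof -
    have "cmod ((P *v x) $ i) \<le> (\<Sum>j\<in>UNIV. cmod (P $ i $ j) * cmod (x $ j))"
      unfolding matrix_vector_mult_def by (simp add: norm_mult order_trans[OF norm_sum])
    also have "\<dots> \<le> norm (P $ i) * norm x"
      using L2_set_mult_ineq[of "\<lambda>j. cmod (P $ i $ j)" "\<lambda>j. cmod (x $ j)" UNIV]
      by (simp add: norm_vec_def)
    finally show ?thesis .
  qed
  then have "norm (P *v x) \<le> L2_set (\<lambda>i. norm x * norm (P $ i)) UNIV"
    unfolding norm_vec_def[of "P *v x"] by (intro L2_set_mono) (auto simp: mult.commute)
  then show ?thesis by (simp add: L2_set_right_distrib[symmetric] norm_vec_def[of P] mult.commute)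
qed

lemma mat_norm_bdd: "bdd_above ((\<lambda>x. norm ((P :: complex^'d^'d) *v x)) ` {x. norm x = 1})"
  by (rule bdd_aboveI[of _ "norm P"]) (auto, metis norm_matrix_vector_le mult.right_neutral)

lemma norm_le_mat_norm: "norm x = 1 \<Longrightarrow> norm (P *v x) \<le> mat_norm P"
  unfolding mat_norm_def by (rule cSUP_upper2[OF mat_norm_bdd]) auto

lemma mat_norm_leI: "(\<And>x. norm x = 1 \<Longrightarrow> norm (P *v x) \<le> c) \<Longrightarrow> mat_norm (P :: complex^'d^'d) \<le> c"
  unfolding mat_norm_def by (rule cSUP_least) (auto intro!: exI[of _ "axis undefined 1"] norm_axis_one)

lemma mat_norm_le_norm: "mat_norm P \<le> norm P"
  by (rule mat_norm_leI) (metis norm_matrix_vector_le mult.right_neutral)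

lemma mat_norm_nonneg: "0 \<le> mat_norm P"
  using norm_le_mat_norm[OF norm_axis_one, of P undefined] by (rule order_trans[OF norm_ge_zero])

lemma mat_norm_add_le: "mat_norm P \<le> mat_norm Q + norm (P - Q)"
proof (rule mat_norm_leI)
  fix x :: "complex^'a" assume x: "norm x = 1"
  have "norm (P *v x) \<le> norm (Q *v x) + norm ((P - Q) *v x)"
    using norm_triangle_ineq[of "Q *v x" "(P - Q) *v x"] by (simp add: matrix_diff_vector)
  also have "\<dots> \<le> mat_norm Q + norm (P - Q)"
    using norm_le_mat_norm[OF x, of Q] norm_matrix_vector_le[of "P - Q" x] x by simp
  finally show "norm (P *v x) \<le> mat_norm Q + norm (P - Q)" .
qed

lemma mat_norm_measurable [measurable]: "mat_norm \<in> borel_measurable (borel :: (complex^'d^'d) measure)"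
proof (rule borel_measurable_continuous_onI)
  have "dist (mat_norm P) (mat_norm Q) \<le> 1 * dist P Q" for P Q :: "complex^'d^'d"
    using mat_norm_add_le[of P Q] mat_norm_add_le[of Q P]
    by (simp add: dist_norm norm_minus_commute abs_le_iff)
  then have "1-lipschitz_on UNIV (mat_norm :: complex^'d^'d \<Rightarrow> real)"
    by (intro lipschitz_onI) auto
  then show "continuous_on UNIV (mat_norm :: complex^'d^'d \<Rightarrow> real)"
    by (rule lipschitz_on_continuous_on)
qed

lemma norm_le_sum_columns: "norm (P :: complex^'d^'d) \<le> (\<Sum>k\<in>UNIV. norm (P *v axis k 1))"
proof -
  have "norm P = L2_set (\<lambda>k. norm (P *v axis k 1)) UNIV"
    unfolding L2_set_def norm_matrix_columns[symmetric] by simp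
  also have "\<dots> \<le> (\<Sum>k\<in>UNIV. norm (P *v axis k 1))"
    by (rule L2_set_le_sum) auto
  finally show ?thesis .
qed

lemma mat_norm_eq_0_iff: "mat_norm P = 0 \<longleftrightarrow> P = 0"
proof
  assume "mat_norm P = 0"
  then have "P *v axis k 1 = 0" for k
    using norm_le_mat_norm[OF norm_axis_one, of P k] by simp
  then show "P = 0" using norm_le_sum_columns[of P] by simp
next
  assume "P = 0"
  then show "mat_norm P = 0" using mat_norm_le_norm[of P] mat_norm_nonneg[of P] by simp
qed


section \<open>Products of independent Gaussian matrices\<close>
lemma finite_type_attains_max:
  fixes f :: "'a::finite \<Rightarrow> real"
  obtains m where "\<And>k. f k \<le> f m"
proof -
  have "Max (range f) \<in> range f" by (rule Max_in) auto
  then obtain m where "Max (range f) = f m" by (rule rangeE)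
  then show ?thesis using Max_ge[of "range f"] by (intro that[of m]) auto
qed

lemma (in prob_space) indep_vars_reindex:
  assumes X: "indep_vars M' X I" and f: "inj_on f L" "f ` L \<subseteq> I"
  shows "indep_vars (\<lambda>j. M' (f j)) (\<lambda>j. X (f j)) L"
proof -
  have "indep_vars (\<lambda>j. PiM {f j} M') (\<lambda>j \<omega>. restrict (\<lambda>i. X i \<omega>) {f j}) L"
    using f by (intro indep_vars_restrict[OF X]) (auto simp: disjoint_family_on_def dest: inj_onD)
  then have "indep_vars (\<lambda>j. M' (f j)) (\<lambda>j \<omega>. (\<lambda>g. g (f j)) (restrict (\<lambda>i. X i \<omega>) {f j})) L"
    by (rule indep_vars_compose2) (auto intro: measurable_component_singleton)
  then show ?thesis by simp
qed

locale gaussian_matrix_sequence = prob_space M for M :: "'w measure" +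
  fixes G :: "nat \<Rightarrow> 'w \<Rightarrow> complex^'d::{finite,linorder}^'d::{finite,linorder}"
  assumes gaussian: "indep_complex_gaussian_matrices M G"
begin

lemma entry_normal: "1 \<le> i \<Longrightarrow> std_complex_normal M (\<lambda>\<omega>. G i \<omega> $ j $ k)"
  using gaussian by (simp add: indep_complex_gaussian_matrices_def)

lemma entries_indep: "indep_vars (\<lambda>_. borel) (\<lambda>(i, j, k) \<omega>. G i \<omega> $ j $ k) ({1..} \<times> UNIV \<times> UNIV)"
  using gaussian by (simp add: indep_complex_gaussian_matrices_def)

lemma G_measurable: assumes i: "1 \<le> i" shows "G i \<in> borel_measurable M"
proof (intro borel_measurable_vectorI)
  fix j k
  show "(\<lambda>\<omega>. G i \<omega> $ j $ k) \<in> borel_measurable M"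
    using distributed_measurable[OF entry_normal[OF i, of j k, unfolded std_complex_normal_def]] by simp
qed

lemma distr_G: "1 \<le> i \<Longrightarrow> distr M borel (G i) = gaussian_matrix"
proof (rule distr_gaussian_matrix)
  assume i: "1 \<le> i"
  have "indep_vars (\<lambda>_. borel) (\<lambda>p. (\<lambda>(i, j, k) \<omega>. G i \<omega> $ j $ k) (i, fst p, snd p)) UNIV"
    by (rule indep_vars_reindex[OF entries_indep]) (use i in \<open>auto simp: inj_on_def prod_eq_iff\<close>)
  then show "indep_vars (\<lambda>_. borel) (\<lambda>(j, k) \<omega>. G i \<omega> $ j $ k) UNIV"
    by (simp add: case_prod_beta')
qed (auto intro: entry_normal prob_space_axioms)

lemma prob_space_gaussian_matrix: "prob_space (gaussian_matrix :: (complex^'d::{finite,linorder}^'d::{finite,linorder}) measure)"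
  using prob_space_distr[OF G_measurable[of 1]] by (simp add: distr_G)

abbreviation product :: "complex^'d::{finite,linorder}^'d::{finite,linorder} \<Rightarrow> nat \<Rightarrow> 'w \<Rightarrow> complex^'d::{finite,linorder}^'d::{finite,linorder}" where
  "product R N \<omega> \<equiv> matrix_product (\<lambda>i. R ** G i \<omega>) N"

lemma product_measurable [measurable]: "product R N \<in> borel_measurable M"
proof (induction N)
  case (Suc N)
  have [measurable]: "G (Suc N) \<in> borel_measurable M" by (rule G_measurable) simp
  from Suc show ?case by simp
qed simp

lemma indep_factor_product: "indep_var borel (product R N) borel (G (Suc N))"
proof -
  let ?X = "\<lambda>(i, j, k) \<omega>. G i \<omega> $ j $ k"
  let ?A = "{1..N} \<times> (UNIV :: 'd::{finite,linorder} set) \<times> (UNIV :: 'd::{finite,linorder} set)" and ?B = "{Suc N} \<times> (UNIV :: 'd::{finite,linorder} set) \<times> (UNIV :: 'd::{finite,linorder} set)"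
  let ?E = "\<lambda>i f. (\<chi> j k. f (i, j, k)) :: complex^'d::{finite,linorder}^'d::{finite,linorder}"
  have E: "?E i \<in> borel_measurable (PiM K (\<lambda>_. borel))" if "{i} \<times> UNIV \<times> UNIV \<subseteq> K" for i :: nat and K
    by (intro borel_measurable_vectorI) (use that in \<open>auto intro!: measurable_component_singleton\<close>)
  have P: "(\<lambda>f. matrix_product (\<lambda>i. R ** ?E i f) n) \<in> borel_measurable (PiM ?A (\<lambda>_. borel))" if "n \<le> N" for n
    using that
  proof (induction n)
    case (Suc n)
    show ?case unfolding matrix_product.simps
      by (intro borel_measurable_matrix_mult borel_measurable_const Suc.IH E) (use Suc in auto)
  qed simp
  have "indep_var (PiM ?A (\<lambda>_. borel)) (\<lambda>\<omega>. restrict (\<lambda>i. ?X i \<omega>) ?A)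
      (PiM ?B (\<lambda>_. borel)) (\<lambda>\<omega>. restrict (\<lambda>i. ?X i \<omega>) ?B)"
    by (rule indep_var_restrict[OF entries_indep]) auto
  from indep_var_compose[OF this P[OF order_refl] E[of "Suc N" ?B]]
  have "indep_var borel (\<lambda>\<omega>. matrix_product (\<lambda>i. R ** ?E i (restrict (\<lambda>i. ?X i \<omega>) ?A)) N)
      borel (\<lambda>\<omega>. ?E (Suc N) (restrict (\<lambda>i. ?X i \<omega>) ?B))"
    by (simp add: o_def)
  also have "(\<lambda>\<omega>. matrix_product (\<lambda>i. R ** ?E i (restrict (\<lambda>i. ?X i \<omega>) ?A)) N) = product R N"
  proof
    fix \<omega>
    have "?E i (restrict (\<lambda>i. ?X i \<omega>) ?A) = G i \<omega>" if "1 \<le> i" "i \<le> N" for i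
      using that by (simp add: vec_eq_iff)
    then have "matrix_product (\<lambda>i. R ** ?E i (restrict (\<lambda>i. ?X i \<omega>) ?A)) n = product R n \<omega>" if "n \<le> N" for n
      using that by (induction n) simp_all
    then show "matrix_product (\<lambda>i. R ** ?E i (restrict (\<lambda>i. ?X i \<omega>) ?A)) N = product R N \<omega>" by simp
  qed
  also have "(\<lambda>\<omega>. ?E (Suc N) (restrict (\<lambda>i. ?X i \<omega>) ?B)) = G (Suc N)"
    by (auto simp: vec_eq_iff)
  finally show ?thesis .
qed

text \<open>Conditioning on the first \<open>N\<close> factors: the next one is independent of their product.\<close>
lemma nn_integral_next_factor:
  assumes [measurable]: "case_prod h \<in> borel_measurable (borel \<Otimes>\<^sub>M borel)"
  shows "(\<integral>\<^sup>+\<omega>. h (product R N \<omega>) (G (Suc N) \<omega>) \<partial>M)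
    = (\<integral>\<^sup>+\<omega>. \<integral>\<^sup>+H. h (product R N \<omega>) H \<partial>gaussian_matrix \<partial>M)"
proof -
  interpret g: prob_space "gaussian_matrix :: (complex^'d::{finite,linorder}^'d::{finite,linorder}) measure" by (rule prob_space_gaussian_matrix)
  have [measurable]: "G (Suc N) \<in> borel_measurable M" by (rule G_measurable) simp
  have "distr M (borel \<Otimes>\<^sub>M borel) (\<lambda>\<omega>. (product R N \<omega>, G (Suc N) \<omega>))
      = distr M borel (product R N) \<Otimes>\<^sub>M gaussian_matrix"
    using indep_factor_product[unfolded indep_var_distribution_eq] by (simp add: distr_G)
  note dist = this
  have "(\<integral>\<^sup>+\<omega>. h (product R N \<omega>) (G (Suc N) \<omega>) \<partial>M)
      = (\<integral>\<^sup>+p. case_prod h p \<partial>distr M (borel \<Otimes>\<^sub>M borel) (\<lambda>\<omega>. (product R N \<omega>, G (Suc N) \<omega>)))"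
    by (subst nn_integral_distr) simp_all
  also have "\<dots> = (\<integral>\<^sup>+p. case_prod h p \<partial>(distr M borel (product R N) \<Otimes>\<^sub>M gaussian_matrix))"
    unfolding dist ..
  also have "\<dots> = (\<integral>\<^sup>+P. \<integral>\<^sup>+H. h P H \<partial>gaussian_matrix \<partial>distr M borel (product R N))"
    by (subst g.nn_integral_fst[symmetric]) (simp_all cong: measurable_cong_sets sets_pair_measure_cong)
  also have "\<dots> = (\<integral>\<^sup>+\<omega>. \<integral>\<^sup>+H. h (product R N \<omega>) H \<partial>gaussian_matrix \<partial>M)"
    by (rule nn_integral_distr) measurable
  finally show ?thesis .
qed

lemma column_power_distributed:
  "distributed M lborel (\<lambda>\<omega>. (cmod (G 1 \<omega> $ j $ a))\<^sup>2) (exponential_density 1)"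
  by (rule std_complex_normal_power2[OF prob_space_axioms entry_normal]) simp

lemma column_power_indep: "indep_vars (\<lambda>_. borel) (\<lambda>j \<omega>. (cmod (G 1 \<omega> $ j $ a))\<^sup>2) UNIV"
proof -
  have "indep_vars (\<lambda>_. borel) (\<lambda>j. (\<lambda>(i, j, k) \<omega>. G i \<omega> $ j $ k) (1, j, a)) UNIV"
    by (rule indep_vars_reindex[OF entries_indep]) (auto simp: inj_on_def)
  then have "indep_vars (\<lambda>_. borel) (\<lambda>j \<omega>. (cmod ((\<lambda>(i, j, k) \<omega>. G i \<omega> $ j $ k) (1, j, a) \<omega>))\<^sup>2) UNIV"
    by (rule indep_vars_compose2) measurable
  then show ?thesis by simp
qed

lemma column_moment_eq:
  fixes y :: "real^'d::{finite,linorder}"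
  assumes inj: "inj (\<lambda>j. y $ j)" and y: "\<And>j. 0 < y $ j" and q: "-2 < q"
  shows "column_moment a q y
    = ennreal (Gamma (1 + q / 2) * (\<Sum>j\<in>UNIV. (y $ j) powr (- q / 2) * lagrange_weight UNIV (($) y) j))"
proof -
  let ?X = "\<lambda>j \<omega>. 1 / y $ j * (cmod (G 1 \<omega> $ j $ a))\<^sup>2"
  have m[measurable]: "G 1 \<in> borel_measurable M" by (rule G_measurable) simp
  have X: "distributed M lborel (?X j) (exponential_density (y $ j))" for j
    using erlang_distributed_mult_const[OF column_power_distributed[of j a], of "1 / y $ j"] y[of j] by simp
  have ind: "indep_vars (\<lambda>_. borel) ?X UNIV"
    by (rule indep_vars_compose2[OF column_power_indep]) measurable
  have "column_moment a q y = (\<integral>\<^sup>+\<omega>. ennreal ((\<Sum>j\<in>UNIV. ?X j \<omega>) powr (q / 2)) \<partial>M)"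
    unfolding column_moment_def distr_G[OF order_refl, symmetric]
    by (subst nn_integral_distr) (simp_all del: One_nat_def)
  also have "\<dots> = ennreal (Gamma (1 + q / 2) * (\<Sum>j\<in>UNIV. (y $ j) powr (- (q / 2)) * lagrange_weight UNIV (($) y) j))"
    by (rule hypoexponential_moment[OF _ _ _ _ X ind]) (use inj y q in auto)
  finally show ?thesis by simp
qed

lemma entry_moment_eq:
  assumes q: "-2 < q"
  shows "entry_moment (a :: 'd::{finite,linorder}) q = ennreal (Gamma (1 + q / 2))"
proof -
  have m[measurable]: "G 1 \<in> borel_measurable M" by (rule G_measurable) simp
  let ?X = "\<lambda>j \<omega>. (cmod (G 1 \<omega> $ j $ a))\<^sup>2"
  have ind: "indep_vars (\<lambda>_. borel) ?X {a}"
    by (rule indep_vars_subset[OF column_power_indep]) simp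
  have "entry_moment a q = (\<integral>\<^sup>+\<omega>. ennreal ((\<Sum>j\<in>{a}. ?X j \<omega>) powr (q / 2)) \<partial>M)"
    unfolding entry_moment_def distr_G[OF order_refl, symmetric]
    by (subst nn_integral_distr) (simp_all add: powr_of_power2 del: One_nat_def)
  also have "\<dots> = ennreal (Gamma (1 + q / 2) * (\<Sum>j\<in>{a}. 1 powr (- (q / 2)) * lagrange_weight {a} (\<lambda>_. 1) j))"
    by (rule hypoexponential_moment[OF _ _ _ _ column_power_distributed ind]) (use q in auto)
  finally show ?thesis by (simp add: lagrange_weight_def)
qed

text \<open>
  In this section the exponent \<open>0\<close> counts events: \<open>x powr 0\<close> is the indicator of \<open>x \<noteq> 0\<close>, so a
  moment of order \<open>0\<close> equal to \<open>1\<close> means that the variable is almost surely nonzero.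
\<close>
lemma AE_row_nonzero:
  fixes r :: "complex^'d::{finite,linorder}"
  assumes r: "r \<noteq> 0"
  shows "AE H in gaussian_matrix. (\<Sum>k\<in>UNIV. r $ k * H $ k $ a) \<noteq> 0"
proof -
  interpret g: prob_space "gaussian_matrix :: (complex^'d::{finite,linorder}^'d::{finite,linorder}) measure"
    by (rule prob_space_gaussian_matrix)
  let ?s = "\<lambda>H :: complex^'d::{finite,linorder}^'d::{finite,linorder}. \<Sum>k\<in>UNIV. r $ k * H $ k $ a"
  have "1 = entry_moment a 0 * ennreal (norm r powr 0)" using r by (simp add: entry_moment_eq)
  also have "\<dots> = (\<integral>\<^sup>+H. indicator {H. ?s H \<noteq> 0} H \<partial>gaussian_matrix)"
    unfolding row_moment[OF r, symmetric] by (intro nn_integral_cong) (auto simp: indicator_def)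
  also have "\<dots> = emeasure gaussian_matrix {H. ?s H \<noteq> 0}"
    by (rule nn_integral_indicator) simp
  finally show ?thesis by (subst g.AE_iff_emeasure_eq_1) simp_all
qed

lemma AE_entry_nonzero: "AE H in gaussian_matrix. H $ a $ a \<noteq> (0 :: complex)" for a :: "'d::{finite,linorder}"
  using AE_row_nonzero[of "axis a 1" a] by (simp add: axis_def mult_delta_left vec_eq_iff)

lemma column_moment_pos:
  fixes y :: "real^'d::{finite,linorder}"
  assumes y: "\<And>j. 0 < y $ j"
  shows "column_moment a q y \<noteq> 0"
proof
  assume "column_moment a q y = 0"
  then have "AE H in gaussian_matrix. ennreal ((\<Sum>j\<in>UNIV. (cmod (H $ j $ a))\<^sup>2 / y $ j) powr (q / 2)) = 0"
    unfolding column_moment_def by (subst (asm) nn_integral_0_iff_AE) simp_all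
  then have "AE H in (gaussian_matrix :: (complex^'d::{finite,linorder}^'d::{finite,linorder}) measure). False"
    using AE_entry_nonzero[of a]
  proof eventually_elim
    case (elim H)
    have "0 < (\<Sum>j\<in>UNIV. (cmod (H $ j $ a))\<^sup>2 / y $ j)"
      using elim(2) y by (intro sum_pos2[of _ a]) (auto intro!: divide_nonneg_pos)
    then have "0 < (\<Sum>j\<in>UNIV. (cmod (H $ j $ a))\<^sup>2 / y $ j) powr (q / 2)" by simp
    then show ?case using elim(1) by (metis ennreal_eq_0_iff not_le)
  qed
  then show False
    using prob_space.AE_False[OF prob_space_gaussian_matrix] by simp
qed

lemma column_moment_0:
  fixes y :: "real^'d::{finite,linorder}"
  assumes y: "\<And>j. 0 < y $ j"
  shows "column_moment a 0 y = 1"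
proof -
  interpret g: prob_space "gaussian_matrix :: (complex^'d::{finite,linorder}^'d::{finite,linorder}) measure" by (rule prob_space_gaussian_matrix)
  have "AE H in gaussian_matrix. ennreal ((\<Sum>j\<in>UNIV. (cmod (H $ j $ a))\<^sup>2 / y $ j) powr (0 / 2)) = 1"
    using AE_entry_nonzero[of a]
  proof eventually_elim
    case (elim H)
    have "0 < (\<Sum>j\<in>UNIV. (cmod (H $ j $ a))\<^sup>2 / y $ j)"
      using elim y by (intro sum_pos2[of _ a]) (auto intro!: divide_nonneg_pos)
    then show ?case by simp
  qed
  then have "column_moment a 0 y = (\<integral>\<^sup>+H. 1 \<partial>(gaussian_matrix :: (complex^'d::{finite,linorder}^'d::{finite,linorder}) measure))"
    unfolding column_moment_def by (rule nn_integral_cong_AE)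
  then show ?thesis by (simp add: g.emeasure_space_1[simplified])
qed

text \<open>
  The parameters may coincide; they are compared with the distinct parameters given by the positions, for
  which the moment is known explicitly.
\<close>
lemma column_moment_finite:
  fixes y :: "real^'d::{finite,linorder}"
  assumes y: "\<And>j. 0 < y $ j" and q: "-2 < q"
  shows "column_moment a q y < \<top>"
proof -
  let ?z = "\<chi> j. real (position j) :: real^'d::{finite,linorder}"
  have z: "0 < ?z $ j" for j using position_pos by simp
  have "inj (\<lambda>j. ?z $ j)" by (auto simp: inj_on_def position_eq_iff)
  then have "column_moment a q ?z < \<top>" using column_moment_eq[OF _ z q] by simp
  then show ?thesis
    using column_moment_compare[of ?z y a q, OF z y]
    by (meson ennreal_mult_less_top ennreal_less_top le_less_trans)
qed

text \<open>The index \<open>undefined\<close> stands for an arbitrary column.\<close>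
definition moment :: "real \<Rightarrow> real^'d::{finite,linorder} \<Rightarrow> real" where
  "moment q y = enn2real (column_moment undefined q y)"

lemma
  fixes y :: "real^'d::{finite,linorder}"
  assumes y: "\<And>j. 0 < y $ j" and q: "-2 < q"
  shows ennreal_moment: "column_moment undefined q y = ennreal (moment q y)"
    and moment_pos: "0 < moment q y"
  using column_moment_finite[OF y q, of undefined] column_moment_pos[OF y, of undefined q]
  by (auto simp: moment_def enn2real_positive_iff zero_less_iff_neq_zero)

lemma lyapunov_formula_eq_ln_moment:
  fixes y :: "real^'d::{finite,linorder}"
  assumes inj: "inj (\<lambda>j. y $ j)" and y: "\<And>j. 0 < y $ j" and q: "-2 < q"
  shows "lyapunov_formula q y = ln (moment q y)"
proof -
  let ?v = "Gamma (1 + q / 2) * (\<Sum>j\<in>UNIV. (y $ j) powr (- q / 2) * lagrange_weight UNIV (($) y) j)"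
  have "ennreal (moment q y) = ennreal ?v"
    using ennreal_moment[OF y q] column_moment_eq[OF inj y q] by simp
  moreover have "0 < ?v"
    using calculation moment_pos[OF y q] ennreal_neg[of ?v] by (cases "0 < ?v") (simp_all add: not_less)
  ultimately have "moment q y = ?v" using moment_pos[OF y q] by simp
  then show ?thesis by (simp add: lyapunov_formula_eq[OF inj])
qed

lemma ln_moment_le:
  fixes y z :: "real^'d::{finite,linorder}"
  assumes y: "\<And>j. 0 < y $ j" and z: "\<And>j. 0 < z $ j" and q: "-2 < q"
  shows "ln (moment q z) - ln (moment q y) \<le> \<bar>q\<bar> / 2 * (\<Sum>j\<in>UNIV. \<bar>ln (z $ j) - ln (y $ j)\<bar>)"
proof -
  let ?d = "\<bar>q\<bar> / 2 * (\<Sum>j\<in>UNIV. \<bar>ln (z $ j) - ln (y $ j)\<bar>)"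
  have "ennreal (moment q z) \<le> ennreal (exp ?d) * ennreal (moment q y)"
    using column_moment_compare[OF y z, of undefined q] by (simp add: ennreal_moment[OF y q] ennreal_moment[OF z q])
  then have "moment q z \<le> exp ?d * moment q y"
    using moment_pos[OF y q] by (simp add: ennreal_mult[symmetric])
  then have "ln (moment q z) \<le> ln (exp ?d * moment q y)"
    using moment_pos[OF z q] by simp
  also have "\<dots> = ?d + ln (moment q y)" using moment_pos[OF y q] by (subst ln_mult) auto
  finally show ?thesis by simp
qed

text \<open>
  The formula is the logarithm of the moment at distinct parameters, and the latter is continuous
  on all positive parameters.
\<close>
lemma lyapunov_formula_tendsto:
  fixes y :: "real^'d::{finite,linorder}"
  assumes y: "\<And>j. 0 < y $ j" and q: "-2 < q"
  shows "(lyapunov_formula q \<longlongrightarrow> ln (moment q y)) (at y within distinct_positive)"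
proof -
  have "((\<lambda>z. \<bar>q\<bar> / 2 * (\<Sum>j\<in>UNIV. \<bar>ln (z $ j) - ln (y $ j)\<bar>)) \<longlongrightarrow>
      \<bar>q\<bar> / 2 * (\<Sum>j\<in>UNIV. \<bar>ln (y $ j) - ln (y $ j)\<bar>)) (at y within distinct_positive)"
    using y by (intro tendsto_intros) (auto simp: less_imp_neq[symmetric])
  then have "((\<lambda>z. \<bar>q\<bar> / 2 * (\<Sum>j\<in>UNIV. \<bar>ln (z $ j) - ln (y $ j)\<bar>)) \<longlongrightarrow> 0) (at y within distinct_positive)"
    by simp
  moreover have "\<forall>\<^sub>F z in at y within distinct_positive.
      norm (lyapunov_formula q z - ln (moment q y)) \<le> \<bar>q\<bar> / 2 * (\<Sum>j\<in>UNIV. \<bar>ln (z $ j) - ln (y $ j)\<bar>)"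
    unfolding eventually_at_filter
  proof (intro always_eventually allI impI)
    fix z :: "real^'d::{finite,linorder}" assume "z \<in> distinct_positive"
    then have z: "\<And>j. 0 < z $ j" "inj (\<lambda>j. z $ j)" by (auto simp: distinct_positive_def)
    show "norm (lyapunov_formula q z - ln (moment q y)) \<le> \<bar>q\<bar> / 2 * (\<Sum>j\<in>UNIV. \<bar>ln (z $ j) - ln (y $ j)\<bar>)"
      using ln_moment_le[OF y z(1) q] ln_moment_le[OF z(1) y q]
      unfolding lyapunov_formula_eq_ln_moment[OF z(2,1) q] real_norm_def abs_le_iff
      by (simp add: abs_minus_commute)
  qed
  ultimately have "((\<lambda>z. lyapunov_formula q z - ln (moment q y)) \<longlongrightarrow> 0) (at y within distinct_positive)"
    by (rule Lim_null_comparison[rotated])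
  then show ?thesis by (simp add: LIM_zero_iff)
qed

lemma norm_product_moment:
  fixes U :: "complex^'d::{finite,linorder}^'d::{finite,linorder}" and y :: "real^'d::{finite,linorder}"
  assumes U: "unitary_matrix U" and y: "\<And>j. 0 < y $ j"
  defines "R \<equiv> pos_def_sqrt (unitary_diag U (\<chi> j. 1 / y $ j))"
  shows "(\<integral>\<^sup>+\<omega>. ennreal (norm (product R N \<omega> *v v) powr q) \<partial>M)
    = column_moment undefined q y ^ N * ennreal (norm v powr q)"
proof (induction N)
  case 0
  then show ?case by (simp add: emeasure_space_1)
next
  case (Suc N)
  have "(\<integral>\<^sup>+\<omega>. ennreal (norm (product R (Suc N) \<omega> *v v) powr q) \<partial>M)
      = (\<integral>\<^sup>+\<omega>. ennreal (norm (R ** G (Suc N) \<omega> *v (product R N \<omega> *v v)) powr q) \<partial>M)"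
    by (simp add: matrix_vector_mul_assoc)
  also have "\<dots> = (\<integral>\<^sup>+\<omega>. \<integral>\<^sup>+H. ennreal (norm (R ** H *v (product R N \<omega> *v v)) powr q) \<partial>gaussian_matrix \<partial>M)"
    by (rule nn_integral_next_factor) measurable
  also have "\<dots> = (\<integral>\<^sup>+\<omega>. column_moment undefined q y * ennreal (norm (product R N \<omega> *v v) powr q) \<partial>M)"
    unfolding R_def norm_moment[OF U y, where a = undefined] ..
  also have "\<dots> = column_moment undefined q y * (\<integral>\<^sup>+\<omega>. ennreal (norm (product R N \<omega> *v v) powr q) \<partial>M)"
    by (rule nn_integral_cmult) measurable
  finally show ?case by (simp add: Suc mult.assoc)
qed

text \<open>
  For \<open>q \<ge> 0\<close> the norm is at most the sum of the norms of the columns. For \<open>q < 0\<close> it is at least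
  the norm of one column, which almost surely does not vanish.
\<close>
lemma mat_norm_moment_upper:
  fixes U :: "complex^'d::{finite,linorder}^'d::{finite,linorder}" and y :: "real^'d::{finite,linorder}"
  assumes U: "unitary_matrix U" and y: "\<And>j. 0 < y $ j"
  defines "R \<equiv> pos_def_sqrt (unitary_diag U (\<chi> j. 1 / y $ j))"
  obtains C where "0 < C"
    "\<And>N. (\<integral>\<^sup>+\<omega>. ennreal (mat_norm (product R N \<omega>) powr q) \<partial>M) \<le> ennreal C * column_moment undefined q y ^ N"
proof (cases "0 \<le> q")
  case True
  define D where "D = real CARD('d)"
  have D: "0 < D" by (simp add: D_def)
  let ?c = "\<lambda>P k. norm (P *v axis k 1)"
  have le: "mat_norm P powr q \<le> D powr q * (\<Sum>k\<in>UNIV. ?c P k powr q)"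
    for P :: "complex^'d::{finite,linorder}^'d::{finite,linorder}"
  proof -
    obtain m where m: "\<And>k. ?c P k \<le> ?c P m"
      using finite_type_attains_max[of "?c P"] by blast
    have "mat_norm P \<le> (\<Sum>k\<in>UNIV. ?c P k)"
      using mat_norm_le_norm norm_le_sum_columns by (rule order_trans)
    also have "\<dots> \<le> D * ?c P m"
      unfolding D_def by (rule sum_bounded_above) (rule m)
    finally have "mat_norm P powr q \<le> (D * ?c P m) powr q"
      using True by (intro powr_mono2 mat_norm_nonneg)
    also have "\<dots> = D powr q * ?c P m powr q" using D by (simp add: powr_mult)
    also have "?c P m powr q \<le> (\<Sum>k\<in>UNIV. ?c P k powr q)"
      by (rule member_le_sum) auto
    finally show ?thesis using D by simp
  qed
  show ?thesis
  proof (rule that)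
    show "0 < D powr q * D" using D by simp
    fix N
    have "(\<integral>\<^sup>+\<omega>. ennreal (mat_norm (product R N \<omega>) powr q) \<partial>M)
        \<le> (\<integral>\<^sup>+\<omega>. ennreal (D powr q) * (\<Sum>k\<in>UNIV. ennreal (?c (product R N \<omega>) k powr q)) \<partial>M)"
      using le by (intro nn_integral_mono) (simp add: ennreal_mult[symmetric] sum_nonneg)
    also have "\<dots> = ennreal (D powr q) * (\<Sum>k\<in>UNIV. \<integral>\<^sup>+\<omega>. ennreal (?c (product R N \<omega>) k powr q) \<partial>M)"
      by (subst nn_integral_cmult, measurable, subst nn_integral_sum) simp_all
    also have "\<dots> = ennreal (D powr q * D) * column_moment undefined q y ^ N"
      unfolding R_def norm_product_moment[OF U y]
      using D by (simp add: norm_axis_one D_def ennreal_mult ennreal_of_nat_eq_real_of_nat mult.assoc)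
    finally show "(\<integral>\<^sup>+\<omega>. ennreal (mat_norm (product R N \<omega>) powr q) \<partial>M)
        \<le> ennreal (D powr q * D) * column_moment undefined q y ^ N" .
  qed
next
  case False
  let ?e = "axis undefined 1 :: complex^'d::{finite,linorder}"
  show ?thesis
  proof (rule that[of 1])
    fix N
    have "1 = (\<integral>\<^sup>+\<omega>. ennreal (norm (product R N \<omega> *v ?e) powr 0) \<partial>M)"
      unfolding R_def norm_product_moment[OF U y] by (simp add: column_moment_0[OF y] norm_axis_one)
    also have "\<dots> = (\<integral>\<^sup>+\<omega>. indicator {\<omega> \<in> space M. product R N \<omega> *v ?e \<noteq> 0} \<omega> \<partial>M)"
      by (intro nn_integral_cong) (auto simp: indicator_def)
    also have "\<dots> = emeasure M {\<omega> \<in> space M. product R N \<omega> *v ?e \<noteq> 0}"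
      by (rule nn_integral_indicator) measurable
    finally have "AE \<omega> in M. product R N \<omega> *v ?e \<noteq> 0"
      by (subst AE_iff_emeasure_eq_1) simp_all
    then have "(\<integral>\<^sup>+\<omega>. ennreal (mat_norm (product R N \<omega>) powr q) \<partial>M)
        \<le> (\<integral>\<^sup>+\<omega>. ennreal (norm (product R N \<omega> *v ?e) powr q) \<partial>M)"
    proof (intro nn_integral_mono_AE, eventually_elim)
      case (elim \<omega>)
      then show ?case
        using False norm_le_mat_norm[OF norm_axis_one, of "product R N \<omega>" undefined]
        by (intro ennreal_leI powr_mono2') auto
    qed
    also have "\<dots> = ennreal 1 * column_moment undefined q y ^ N"
      unfolding R_def norm_product_moment[OF U y] by (simp add: norm_axis_one)
    finally show "(\<integral>\<^sup>+\<omega>. ennreal (mat_norm (product R N \<omega>) powr q) \<partial>M)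
        \<le> ennreal 1 * column_moment undefined q y ^ N" .
  qed simp
qed

text \<open>
  The vector \<open>H *v axis a 1\<close> is standard Gaussian. The norm of its image is at least the modulus of
  the entry that belongs to the longest row of \<open>P\<close>, and that modulus is distributed as the length of
  the row times the modulus of a standard complex normal. This is where \<open>q > -2\<close> is essential.
\<close>
lemma gaussian_vector_moment_le:
  fixes P :: "complex^'d::{finite,linorder}^'d::{finite,linorder}"
  assumes q: "-2 < q" "q < 0"
  shows "(\<integral>\<^sup>+H. ennreal (norm (P *v (H *v axis a 1)) powr q) \<partial>gaussian_matrix)
    \<le> ennreal (Gamma (1 + q / 2) * real CARD('d) powr (- q)) * ennreal (mat_norm P powr q)"
proof (cases "P = 0")
  case True
  then show ?thesis by simp
next
  case False
  define D where "D = real CARD('d)"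
  have D: "0 < D" by (simp add: D_def)
  obtain i where i: "\<And>j. norm (P $ j) \<le> norm (P $ i)"
    using finite_type_attains_max[of "\<lambda>j. norm (P $ j)"] by blast
  have "mat_norm P \<le> norm P" by (rule mat_norm_le_norm)
  also have "\<dots> \<le> (\<Sum>j\<in>UNIV. norm (P $ j))"
    unfolding norm_vec_def[of P] by (rule L2_set_le_sum) auto
  also have "\<dots> \<le> D * norm (P $ i)"
    unfolding D_def by (rule sum_bounded_above) (rule i)
  finally have le: "mat_norm P \<le> D * norm (P $ i)" .
  have pos: "0 < mat_norm P" using False mat_norm_nonneg[of P] mat_norm_eq_0_iff[of P] by simp
  then have "0 < D * norm (P $ i)" using le by linarith
  then have nz: "P $ i \<noteq> 0" by auto
  have "norm (P $ i) powr q \<le> (mat_norm P / D) powr q"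
    using q pos le D by (intro powr_mono2') (auto simp: field_simps)
  also have "\<dots> = D powr (- q) * mat_norm P powr q"
    using D pos by (simp add: powr_divide powr_minus field_simps)
  finally have row: "norm (P $ i) powr q \<le> D powr (- q) * mat_norm P powr q" .
  have "(\<integral>\<^sup>+H. ennreal (norm (P *v (H *v axis a 1)) powr q) \<partial>gaussian_matrix)
      \<le> (\<integral>\<^sup>+H. ennreal (cmod (\<Sum>k\<in>UNIV. P $ i $ k * H $ k $ a) powr q) \<partial>gaussian_matrix)"
    using AE_row_nonzero[OF nz, of a]
  proof (intro nn_integral_mono_AE, eventually_elim)
    case (elim H)
    have "cmod (\<Sum>k\<in>UNIV. P $ i $ k * H $ k $ a) \<le> norm (P *v (H *v axis a 1))"
      using Finite_Cartesian_Product.norm_nth_le[of "P *v (H *v axis a 1)" i]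
      by (simp add: matrix_vector_mult_def axis_def mult_delta_right)
    then show ?case using elim q by (intro ennreal_leI powr_mono2') auto
  qed
  also have "\<dots> = ennreal (Gamma (1 + q / 2)) * ennreal (norm (P $ i) powr q)"
    using q by (simp add: row_moment[OF nz] entry_moment_eq)
  also have "\<dots> \<le> ennreal (Gamma (1 + q / 2)) * ennreal (D powr (- q) * mat_norm P powr q)"
    using row by (intro mult_left_mono ennreal_leI) auto
  finally show ?thesis
    using q by (simp add: D_def ennreal_mult[symmetric] Gamma_real_pos less_imp_le mult.assoc)
qed

text \<open>
  For \<open>q < 0\<close> the moments of \<open>norm (P\<^sub>N *v x)\<close> are averaged over a Gaussian vector \<open>x\<close> that is independent
  of the product. Integrating first over the product gives a multiple of \<open>m ^ N\<close>;
  integrating first over \<open>x\<close> gives at most a constant times the moment of the matrix norm.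
\<close>
lemma mat_norm_moment_lower:
  fixes U :: "complex^'d::{finite,linorder}^'d::{finite,linorder}" and y :: "real^'d::{finite,linorder}"
  assumes U: "unitary_matrix U" and y: "\<And>j. 0 < y $ j" and q: "-2 < q"
  defines "R \<equiv> pos_def_sqrt (unitary_diag U (\<chi> j. 1 / y $ j))"
  obtains c where "0 < c"
    "\<And>N. ennreal c * column_moment undefined q y ^ N \<le> (\<integral>\<^sup>+\<omega>. ennreal (mat_norm (product R N \<omega>) powr q) \<partial>M)"
proof (cases "0 \<le> q")
  case True
  let ?e = "axis undefined 1 :: complex^'d::{finite,linorder}"
  show ?thesis
  proof (rule that[of 1])
    fix N
    have "ennreal 1 * column_moment undefined q y ^ N = (\<integral>\<^sup>+\<omega>. ennreal (norm (product R N \<omega> *v ?e) powr q) \<partial>M)"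
      unfolding R_def norm_product_moment[OF U y] by (simp add: norm_axis_one)
    also have "\<dots> \<le> (\<integral>\<^sup>+\<omega>. ennreal (mat_norm (product R N \<omega>) powr q) \<partial>M)"
      using True by (intro nn_integral_mono ennreal_leI powr_mono2 norm_le_mat_norm norm_axis_one) auto
    finally show "ennreal 1 * column_moment undefined q y ^ N
      \<le> (\<integral>\<^sup>+\<omega>. ennreal (mat_norm (product R N \<omega>) powr q) \<partial>M)" .
  qed simp
next
  case False
  interpret g: prob_space "gaussian_matrix :: (complex^'d::{finite,linorder}^'d::{finite,linorder}) measure"
    by (rule prob_space_gaussian_matrix)
  interpret Mg: pair_sigma_finite M "gaussian_matrix :: (complex^'d::{finite,linorder}^'d::{finite,linorder}) measure" ..
  let ?e = "axis undefined 1 :: complex^'d::{finite,linorder}"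
  define C where "C = Gamma (1 + q / 2) * real CARD('d) powr (- q)"
  have C: "0 < C" using q by (simp add: C_def Gamma_real_pos)
  define K where "K = (\<integral>\<^sup>+H. ennreal (norm (H *v ?e) powr q) \<partial>gaussian_matrix)"
  have "K \<noteq> 0"
  proof
    assume "K = 0"
    then have "AE H in gaussian_matrix. ennreal (norm (H *v ?e) powr q) = 0"
      unfolding K_def by (subst (asm) nn_integral_0_iff_AE) simp_all
    then have "AE H in (gaussian_matrix :: (complex^'d::{finite,linorder}^'d::{finite,linorder}) measure). False"
      using AE_entry_nonzero[of undefined]
    proof eventually_elim
      case (elim H)
      have "H $ undefined $ undefined = (H *v ?e) $ undefined"
        by (simp add: matrix_vector_mult_def axis_def mult_delta_right)
      then have "H *v ?e \<noteq> 0" using elim(2) by auto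
      then show ?case using elim(1) by simp
    qed
    then show False using g.AE_False by simp
  qed
  then obtain k where k: "0 < k" "ennreal k \<le> K"
  proof (cases K)
    case (real r)
    then have "0 < r" using \<open>K \<noteq> 0\<close> by (cases "r = 0") auto
    then show ?thesis using real that by simp
  next
    case top
    then show ?thesis using that[of 1] by simp
  qed
  show ?thesis
  proof (rule that)
    show "0 < k / C" using k C by simp
    fix N
    let ?E = "\<integral>\<^sup>+\<omega>. ennreal (mat_norm (product R N \<omega>) powr q) \<partial>M"
    have "ennreal k * column_moment undefined q y ^ N \<le> K * column_moment undefined q y ^ N"
      using k(2) by (rule mult_right_mono) simp
    also have "\<dots> = (\<integral>\<^sup>+H. column_moment undefined q y ^ N * ennreal (norm (H *v ?e) powr q) \<partial>gaussian_matrix)"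
      unfolding K_def by (subst nn_integral_cmult) (simp_all add: mult.commute)
    also have "\<dots> = (\<integral>\<^sup>+H. \<integral>\<^sup>+\<omega>. ennreal (norm (product R N \<omega> *v (H *v ?e)) powr q) \<partial>M \<partial>gaussian_matrix)"
      unfolding R_def norm_product_moment[OF U y] ..
    also have "\<dots> = (\<integral>\<^sup>+\<omega>. \<integral>\<^sup>+H. ennreal (norm (product R N \<omega> *v (H *v ?e)) powr q) \<partial>gaussian_matrix \<partial>M)"
      by (rule Mg.Fubini') measurable
    also have "\<dots> \<le> (\<integral>\<^sup>+\<omega>. ennreal C * ennreal (mat_norm (product R N \<omega>) powr q) \<partial>M)"
      unfolding C_def using q False by (intro nn_integral_mono gaussian_vector_moment_le) auto
    also have "\<dots> = ennreal C * ?E"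
      by (rule nn_integral_cmult) measurable
    finally have "ennreal (1 / C) * (ennreal k * column_moment undefined q y ^ N) \<le> ennreal (1 / C) * (ennreal C * ?E)"
      by (rule mult_left_mono) simp
    then show "ennreal (k / C) * column_moment undefined q y ^ N \<le> ?E"
      using k C by (simp add: mult.assoc[symmetric] ennreal_mult[symmetric])
  qed
qed

text \<open>The constant factors of the two bounds disappear after division by \<open>N\<close>.\<close>
lemma has_gen_lyapunov_exponent_ln_moment:
  fixes U :: "complex^'d::{finite,linorder}^'d::{finite,linorder}" and y :: "real^'d::{finite,linorder}"
  assumes U: "unitary_matrix U" and y: "\<And>j. 0 < y $ j" and q: "-2 < q"
  defines "R \<equiv> pos_def_sqrt (unitary_diag U (\<chi> j. 1 / y $ j))"
  shows "has_gen_lyapunov_exponent M (\<lambda>i \<omega>. R ** G i \<omega>) q (ln (moment q y))"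
proof -
  let ?m = "moment q y"
  note m = moment_pos[OF y q] and em = ennreal_moment[OF y q]
  obtain C where C: "0 < C"
    "\<And>N. (\<integral>\<^sup>+\<omega>. ennreal (mat_norm (product R N \<omega>) powr q) \<partial>M) \<le> ennreal C * column_moment undefined q y ^ N"
    using mat_norm_moment_upper[OF U y, of q] unfolding R_def by blast
  obtain c where c: "0 < c"
    "\<And>N. ennreal c * column_moment undefined q y ^ N \<le> (\<integral>\<^sup>+\<omega>. ennreal (mat_norm (product R N \<omega>) powr q) \<partial>M)"
    using mat_norm_moment_lower[OF U y q] unfolding R_def by blast
  let ?E = "\<lambda>N. \<integral>\<omega>. mat_norm (product R N \<omega>) powr q \<partial>M"
  have int: "integrable M (\<lambda>\<omega>. mat_norm (product R N \<omega>) powr q)" for N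
  proof (rule integrableI_nonneg)
    have "(\<integral>\<^sup>+\<omega>. ennreal (mat_norm (product R N \<omega>) powr q) \<partial>M) \<le> ennreal C * ennreal ?m ^ N"
      using C(2)[of N] by (simp add: em)
    also have "\<dots> < \<infinity>" using m by (simp add: ennreal_power ennreal_mult_less_top)
    finally show "(\<integral>\<^sup>+\<omega>. ennreal (mat_norm (product R N \<omega>) powr q) \<partial>M) < \<infinity>" .
  qed auto
  have nn: "(\<integral>\<^sup>+\<omega>. ennreal (mat_norm (product R N \<omega>) powr q) \<partial>M) = ennreal (?E N)" for N
    by (rule nn_integral_eq_integral[OF int]) simp
  have E0: "0 \<le> ?E N" for N by (simp add: integral_nonneg_AE)
  have upper: "?E N \<le> C * ?m ^ N" for N
    using C(1) C(2)[of N] m by (simp add: nn em ennreal_power ennreal_mult[symmetric])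
  have lower: "c * ?m ^ N \<le> ?E N" for N
    using c(1) c(2)[of N] m E0[of N] by (simp add: nn em ennreal_power ennreal_mult[symmetric])
  have "(\<lambda>N. 1 / real N * ln (?E N)) \<longlonglongrightarrow> ln ?m"
  proof (rule tendsto_sandwich)
    have *: "ln (a * ?m ^ N) = ln a + real N * ln ?m" if "0 < a" for a N
      using that m by (simp add: ln_mult ln_realpow)
    show "\<forall>\<^sub>F N in sequentially. ln c / real N + ln ?m \<le> 1 / real N * ln (?E N)"
    proof (rule eventually_sequentiallyI[of 1])
      fix N :: nat assume N: "1 \<le> N"
      have "0 < c * ?m ^ N" using c m by simp
      then have "ln (c * ?m ^ N) \<le> ln (?E N)"
        using lower[of N] by (subst ln_le_cancel_iff) linarith+
      then have "(ln c + real N * ln ?m) / real N \<le> ln (?E N) / real N"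
        unfolding *[OF c(1)] by (rule divide_right_mono) simp
      then show "ln c / real N + ln ?m \<le> 1 / real N * ln (?E N)"
        using N by (simp add: add_divide_distrib)
    qed
    show "\<forall>\<^sub>F N in sequentially. 1 / real N * ln (?E N) \<le> ln C / real N + ln ?m"
    proof (rule eventually_sequentiallyI[of 1])
      fix N :: nat assume N: "1 \<le> N"
      have "0 < c * ?m ^ N" using c m by simp
      then have "ln (?E N) \<le> ln (C * ?m ^ N)"
        using lower[of N] upper[of N] by (subst ln_le_cancel_iff) linarith+
      then have "ln (?E N) / real N \<le> (ln C + real N * ln ?m) / real N"
        unfolding *[OF C(1)] by (rule divide_right_mono) simp
      then show "1 / real N * ln (?E N) \<le> ln C / real N + ln ?m"
        using N by (simp add: add_divide_distrib)
    qed
    show "(\<lambda>N. ln c / real N + ln ?m) \<longlonglongrightarrow> ln ?m"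
      using tendsto_add[OF lim_const_over_n tendsto_const, of "ln c" "ln ?m"] by simp
    show "(\<lambda>N. ln C / real N + ln ?m) \<longlonglongrightarrow> ln ?m"
      using tendsto_add[OF lim_const_over_n tendsto_const, of "ln C" "ln ?m"] by simp
  qed
  then show ?thesis using int by (simp add: has_gen_lyapunov_exponent_def)
qed

end

theorem mainTheorem5:
  fixes M :: "'w measure"
    and S :: "complex^'d::{finite,linorder}^'d::{finite,linorder}"
    and G :: "nat \<Rightarrow> 'w \<Rightarrow> complex^'d::{finite,linorder}^'d::{finite,linorder}"
    and y :: "real^'d::{finite,linorder}"
    and q :: real
  assumes "prob_space M"
    and "pos_def S"
    and "indep_complex_gaussian_matrices M G"
    and "eigenvalues_of (matrix_inv S) y"
    and "q > -2"
  shows "\<exists>L. has_gen_lyapunov_exponent M (\<lambda>i \<omega>. pos_def_sqrt S ** G i \<omega>) q L \<and>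
           (if inj (\<lambda>j. y $ j) then L = lyapunov_formula q y
            else (lyapunov_formula q \<longlongrightarrow> L) (at y within distinct_positive))"
proof -
  interpret prob_space M by fact
  interpret gaussian_matrix_sequence M G by standard fact
  obtain U where U: "unitary_matrix U" and S: "S = unitary_diag U (\<chi> j. 1 / y $ j)"
    and y: "\<And>j. 0 < y $ j"
    using pos_def_eigenbasis[OF assms(2,4)] by blast
  show ?thesis
    using has_gen_lyapunov_exponent_ln_moment[OF U y assms(5)] lyapunov_formula_eq_ln_moment[OF _ y assms(5)]
      lyapunov_formula_tendsto[OF y assms(5)]
    unfolding S by (intro exI[of _ "ln (moment q y)"]) auto
qed

end
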